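(* Let $a,b$ be positive integers with $\gcd(a,b)=1$, and let ${\sf core}(a,b)$ be the (finite) set of simultaneous $(a,b)$-cores. Then the variance of ${\sf size}$ over ${\sf core}(a,b)$ (with respect to the uniform distribution) is \[\mathbb{V}_{\lambda \in {\sf core}(a,b)}\big({\sf size}(\lambda)\big) = \frac{ab(a-1)(b-1)(a+b)(a+b+1)}{1440}.\]
   Context: An integer partition $\lambda$ is an $a$-core if no hook length of its Ferrers diagram is divisible by $a$. An $(a,b)$-core is a partition that is both an $a$-core and a $b$-core. For a partition $\lambda$ of $k$, ${\sf size}(\lambda):=k$ (the number of boxes). The variance is $\mathbb{V}(X)=\frac{1}{N}\sum_{\lambda}(X(\lambda)-\mu)^2$, where the sum is over the $N=|{\sf core}(a,b)|$ elements of ${\sf core}(a,b)$ and $\mu$ is the average of ${\sf size}$ over ${\sf core}(a,b)$. *)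

theory Defs
  imports Complex_Main
begin

definition is_partition :: "nat list \<Rightarrow> bool" where
  "is_partition p \<longleftrightarrow> sorted_wrt (\<ge>) p \<and> (\<forall>k \<in> set p. 0 < k)"

definition partition_size :: "nat list \<Rightarrow> nat" where
  "partition_size p = sum_list p"

text \<open>Boxes are pairs (row, column), counted from 0.\<close>

definition ferrers :: "nat list \<Rightarrow> (nat \<times> nat) set" where
  "ferrers p = {(i, j). i < length p \<and> j < p ! i}"

text \<open>The hook of a box consists of the box itself, the boxes to its right in the same row
  (the arm) and the boxes below it in the same column (the leg).\<close>

definition hook :: "nat list \<Rightarrow> nat \<times> nat \<Rightarrow> (nat \<times> nat) set" where
  "hook p c = {(i, j) \<in> ferrers p.
     (i = fst c \<and> snd c \<le> j) \<or> (j = snd c \<and> fst c \<le> i)}"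

definition hook_length :: "nat list \<Rightarrow> nat \<times> nat \<Rightarrow> nat" where
  "hook_length p c = card (hook p c)"

definition is_core :: "nat \<Rightarrow> nat list \<Rightarrow> bool" where
  "is_core a p \<longleftrightarrow> is_partition p \<and> (\<forall>c \<in> ferrers p. \<not> a dvd hook_length p c)"

definition core :: "nat \<Rightarrow> nat \<Rightarrow> nat list set" where
  "core a b = {p. is_core a p \<and> is_core b p}"

text \<open>Mean and variance of a statistic under the uniform distribution on a finite nonempty set.\<close>

definition mean_over :: "'a set \<Rightarrow> ('a \<Rightarrow> real) \<Rightarrow> real" where
  "mean_over S X = (\<Sum>x\<in>S. X x) / real (card S)"

definition variance_over :: "'a set \<Rightarrow> ('a \<Rightarrow> real) \<Rightarrow> real" where
  "variance_over S X = (\<Sum>x\<in>S. (X x - mean_over S X)\<^sup>2) / real (card S)"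

end

theory Submission
  imports Defs "HOL-Number_Theory.Cong"
begin

text \<open>
  The first column hook lengths identify \<open>(a, b)\<close>-cores with the finite sets \<open>X\<close> of positive integers
  closed under subtracting \<open>a\<close> and \<open>b\<close>. Let \<open>u j\<close> be the least natural number outside \<open>X\<close> congruent to
  \<open>j * b\<close> modulo \<open>a\<close>. Then the numbers \<open>z j = (u j + b - u (j + 1)) / a\<close> form a weak composition of \<open>b\<close>
  into \<open>a\<close> parts, and the compositions that arise are the rational Dyck paths \<open>u \<ge> 0\<close>. Up to an additive
  constant the size of the core is half the variance of \<open>u\<close>, which in terms of \<open>z\<close> is
  \<open>- 1/4 * (\<Sum>i j. d (a - d) * z i * z j)\<close> with \<open>d = \<bar>i - j\<bar>\<close>. This form is invariant under cyclic
  rotation, and by coprimality every rotation class has \<open>a\<close> members, exactly one of them Dyck.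
  Hence one may average over all compositions, whose factorial moments are binomial coefficients.
\<close>

section \<open>Cores and first column hook lengths\<close>

text \<open>A row of length \<open>q\<close> with \<open>length p\<close> rows below it has first
  column hook length \<open>q + length p\<close>, so this is the set of first column hook
  lengths.\<close>

fun beta :: "nat list \<Rightarrow> nat set" where
  "beta [] = {}"
| "beta (q # p) = insert (q + length p) (beta p)"

lemma is_partition_Cons:
  "is_partition (q # p) \<longleftrightarrow> 0 < q \<and> (\<forall>r\<in>set p. r \<le> q) \<and> is_partition p"
  by (auto simp: is_partition_def)

lemma finite_beta [simp]: "finite (beta p)"
  by (induction p) auto

lemma beta_less: "\<lbrakk>\<forall>r\<in>set p. r \<le> q; x \<in> beta p\<rbrakk> \<Longrightarrow> x < q + length p"
  by (induction p arbitrary: q) (auto, force)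

lemma beta_less_Cons: "is_partition (q # p) \<Longrightarrow> x \<in> beta p \<Longrightarrow> x < q + length p"
  using beta_less by (auto simp: is_partition_Cons)

lemma card_beta: "is_partition p \<Longrightarrow> card (beta p) = length p"
proof (induction p)
  case (Cons q p)
  then show ?case
    using beta_less_Cons[OF Cons.prems, of "q + length p"] by (auto simp: is_partition_Cons card_insert_if)
qed auto

lemma zero_notin_beta: "is_partition p \<Longrightarrow> 0 \<notin> beta p"
  by (induction p) (auto simp: is_partition_Cons)

lemma sum_beta: "is_partition p \<Longrightarrow> \<Sum>(beta p) = partition_size p + \<Sum>{..<length p}"
proof (induction p)
  case (Cons q p)
  then have "q + length p \<notin> beta p"
    using beta_less_Cons by blast
  then show ?case
    using Cons by (auto simp: is_partition_Cons partition_size_def)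
qed (auto simp: partition_size_def)

text \<open>The cardinality gives the number of rows, the maximum then gives the first row, and
  removing the maximum leaves the set of the remaining rows.\<close>

lemma inj_on_beta: "inj_on beta {p. is_partition p}"
proof -
  have "beta p = beta p' \<Longrightarrow> p = p'" if "is_partition p" "is_partition p'" for p p'
    using that
  proof (induction p arbitrary: p')
    case Nil
    then show ?case by (cases p') auto
  next
    case (Cons q p)
    then obtain q' r where p': "p' = q' # r" by (cases p') auto
    have len: "length p = length r"
      using Cons.prems card_beta p' by (metis length_Cons nat.inject)
    have Mx: "Max (beta (q # p)) = q + length p" if "is_partition (q # p)" for q p
      using beta_less_Cons[OF that] by (intro Max_eqI) (auto simp: less_imp_le)
    have q: "q = q'"
      using Mx[OF Cons.prems(2)] Mx[of q' r] Cons.prems p' len by simp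
    have remove: "beta p = beta (q # p) - {q + length p}" if "is_partition (q # p)" for q p
      using beta_less_Cons[OF that] by auto
    have "beta p = beta r"
      using remove[OF Cons.prems(2)] remove[of q' r] Cons.prems(1,3) p' q len by metis
    then show ?case
      using Cons.IH[of r] Cons.prems p' q by (auto simp: is_partition_Cons)
  qed
  then show ?thesis by (auto intro!: inj_onI)
qed

text \<open>Elements are added in increasing order, each as a new first row of length
  \<open>m - length p\<close>. As \<open>m\<close> exceeds the previous maximum
  \<open>q + length r\<close>, this row is at least as long as those below it.\<close>

lemma beta_surj:
  assumes "finite X" "0 \<notin> X"
  shows "\<exists>p. is_partition p \<and> beta p = X"
  using assms
proof (induction X rule: finite_linorder_max_induct)
  case empty
  then show ?case by (intro exI[of _ "[]"]) (auto simp: is_partition_def)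
next
  case (insert m X)
  then obtain p where p: "is_partition p" "beta p = X" by auto
  have *: "length p < m \<and> (\<forall>r\<in>set p. r \<le> m - length p)"
  proof (cases p)
    case Nil
    with insert.prems show ?thesis by auto
  next
    case (Cons q r)
    then have "q + length r < m" using p insert.hyps by auto
    then show ?thesis using Cons p by (auto simp: is_partition_Cons)
  qed
  then show ?case
    using p by (intro exI[of _ "(m - length p) # p"]) (auto simp: is_partition_Cons)
qed

section \<open>Hook lengths as differences between first column hook lengths and gaps\<close>

lemma hook_length_Cons_Suc: "hook_length (q # p) (Suc i, j) = hook_length p (i, j)"
proof -
  have "hook (q # p) (Suc i, j) = map_prod Suc id ` hook p (i, j)"
    by (auto simp: hook_def ferrers_def less_Suc_eq_0_disj map_prod_def image_iff split: prod.splits)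
  then show ?thesis
    by (auto simp: hook_length_def intro!: card_image inj_onI)
qed

lemma hook_length_Cons_0:
  assumes "j < q"
  shows "hook_length (q # p) (0, j) = q - j + length (filter ((<) j) p)"
proof -
  let ?I = "{i. i < length p \<and> j < p ! i}"
  have "hook (q # p) (0, j) = Pair 0 ` {j..<q} \<union> (\<lambda>i. (Suc i, j)) ` ?I"
    using assms by (auto simp: hook_def ferrers_def less_Suc_eq_0_disj)
  moreover have "card (Pair (0::nat) ` {j..<q}) = q - j"
    by (subst card_image) (auto intro: inj_onI)
  moreover have "card ((\<lambda>i. (Suc i, j)) ` ?I) = length (filter ((<) j) p)"
    by (subst card_image) (auto intro: inj_onI simp: length_filter_conv_card)
  ultimately show ?thesis
    unfolding hook_length_def by (subst (asm) card_Un_disjoint[symmetric] | subst card_Un_disjoint | auto)+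
qed

text \<open>Induction on the rows below the first. Columns inside the second row \<open>r\<close>
  repeat the hooks of that row up to a shift and match the gaps below \<open>r + length p\<close>;
  the remaining columns have no leg and match the run of gaps between the two largest first column
  hook lengths.\<close>

lemma first_row_hooks:
  assumes "is_partition (q # p)"
  shows "(\<lambda>j. q - j + length (filter ((<) j) p)) ` {..<q}
    = (\<lambda>y. q + length p - y) ` ({..<q + length p} - beta p)"
  using assms
proof (induction p arbitrary: q)
  case (Cons r p)
  let ?n = "length p"
  have rq: "r \<le> q" and part: "is_partition (r # p)" and rp: "\<forall>s\<in>set p. s \<le> r"
    using Cons.prems by (auto simp: is_partition_Cons)
  have "(\<lambda>j. q - j + length (filter ((<) j) (r # p))) ` {..<q}
      = (\<lambda>j. q - j + length (filter ((<) j) (r # p))) ` {..<r}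
        \<union> (\<lambda>j. q - j + length (filter ((<) j) (r # p))) ` {r..<q}"
  proof -
    have "{..<q} = {..<r} \<union> {r..<q}" using rq by auto
    then show ?thesis by (simp only: image_Un)
  qed
  \<comment> \<open>Passing from row \<open>r\<close> to the row \<open>q\<close> above it lengthens
    the arm by \<open>q - r\<close> and the leg by one.\<close>
  also have "(\<lambda>j. q - j + length (filter ((<) j) (r # p))) ` {..<r}
      = (+) (q - r + 1) ` (\<lambda>j. r - j + length (filter ((<) j) p)) ` {..<r}"
    unfolding image_image using rq by (intro image_cong) auto
  also have "\<dots> = (+) (q - r + 1) ` (\<lambda>y. r + ?n - y) ` ({..<r + ?n} - beta p)"
    using Cons.IH[OF part] by simp
  also have "\<dots> = (\<lambda>y. q + length (r # p) - y) ` ({..<r + ?n} - beta p)"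
    unfolding image_image using rq by (intro image_cong) auto
  also have "(\<lambda>j. q - j + length (filter ((<) j) (r # p))) ` {r..<q} = (\<lambda>j. q - j) ` {r..<q}"
  proof (intro image_cong refl)
    fix j assume "j \<in> {r..<q}"
    then have "filter ((<) j) (r # p) = []"
      using rp by (auto simp: filter_empty_conv not_less intro: order_trans)
    then show "q - j + length (filter ((<) j) (r # p)) = q - j" by simp
  qed
  also have "\<dots> = (\<lambda>y. q + length (r # p) - y) ` (\<lambda>j. j + ?n + 1) ` {r..<q}"
    unfolding image_image by (intro image_cong) auto
  also have "(\<lambda>j. j + ?n + 1) ` {r..<q} = {r + ?n + 1..<q + ?n + 1}"
    using image_add_atLeastLessThan'[of "?n + 1" r q] by (simp add: add.assoc)
  also have "(\<lambda>y. q + length (r # p) - y) ` ({..<r + ?n} - beta p)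
        \<union> (\<lambda>y. q + length (r # p) - y) ` {r + ?n + 1..<q + ?n + 1}
      = (\<lambda>y. q + length (r # p) - y) ` ({..<q + length (r # p)} - beta (r # p))"
  proof -
    have "{..<q + length (r # p)} - beta (r # p)
        = ({..<r + ?n} - beta p) \<union> {r + ?n + 1..<q + ?n + 1}"
      using rq beta_less_Cons[OF part] by fastforce
    then show ?thesis by (simp only: image_Un)
  qed
  finally show ?case .
next
  case Nil
  then show ?case by auto
qed

text \<open>Row by row, the hook lengths are exactly the differences \<open>x - y\<close> with
  \<open>x\<close> the first column hook length of the row and \<open>y\<close> a gap below it. The
  predicate \<open>P\<close> is kept general, as only the set of hook lengths matters.\<close>

lemma hooks_iff_beta:
  assumes "is_partition p"
  shows "(\<forall>c\<in>ferrers p. P (hook_length p c))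
    \<longleftrightarrow> (\<forall>x\<in>beta p. \<forall>y<x. y \<notin> beta p \<longrightarrow> P (x - y))"
  using assms
proof (induction p)
  case Nil
  then show ?case by (auto simp: ferrers_def)
next
  case (Cons q p)
  let ?x = "q + length p"
  have part: "is_partition p" using Cons.prems by (auto simp: is_partition_Cons)
  have "ferrers (q # p) = Pair 0 ` {..<q} \<union> map_prod Suc id ` ferrers p"
    by (auto simp: ferrers_def less_Suc_eq_0_disj map_prod_def image_iff split: prod.splits)
  then have "(\<forall>c\<in>ferrers (q # p). P (hook_length (q # p) c))
    \<longleftrightarrow> (\<forall>h\<in>(\<lambda>j. q - j + length (filter ((<) j) p)) ` {..<q}. P h)
      \<and> (\<forall>c\<in>ferrers p. P (hook_length p c))"
    by (auto simp: ball_Un hook_length_Cons_0 hook_length_Cons_Suc)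
  also have "\<dots> \<longleftrightarrow> (\<forall>y<?x. y \<notin> beta p \<longrightarrow> P (?x - y))
      \<and> (\<forall>x\<in>beta p. \<forall>y<x. y \<notin> beta p \<longrightarrow> P (x - y))"
    unfolding first_row_hooks[OF Cons.prems] Cons.IH[OF part] by auto
  also have "\<dots> \<longleftrightarrow> (\<forall>x\<in>beta (q # p). \<forall>y<x. y \<notin> beta (q # p) \<longrightarrow> P (x - y))"
  proof -
    \<comment> \<open>The new element exceeds all old ones, so adjoining it fills no gap below any
      of them.\<close>
    have "y \<noteq> ?x" if "x \<in> beta p" "y < x" for x y
      using beta_less_Cons[OF Cons.prems] that by fastforce
    moreover have "y \<noteq> ?x" if "y < ?x" for y using that by blast
    ultimately show ?thesis
      unfolding beta.simps ball_simps insert_iff by blast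
  qed
  finally show ?case .
qed

section \<open>The core condition as closure under subtraction\<close>

lemma closed_under_multiples:
  fixes X :: "nat set"
  assumes "\<And>x. x \<in> X \<Longrightarrow> a \<le> x \<Longrightarrow> x - a \<in> X"
  shows "x \<in> X \<Longrightarrow> k * a \<le> x \<Longrightarrow> x - k * a \<in> X"
proof (induction k)
  case (Suc k)
  then have "x - k * a - a \<in> X"
    by (intro assms) auto
  then show ?case by (simp add: algebra_simps)
qed simp

text \<open>A gap \<open>y\<close> below \<open>x\<close> with \<open>a dvd x - y\<close> is reached
  from \<open>x\<close> by repeatedly subtracting \<open>a\<close>, which closure forbids;
  conversely a failure of closure at \<open>x\<close> exhibits the gap \<open>x - a\<close>, giving
  a hook of length \<open>a\<close>.\<close>

lemma is_core_iff_beta: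
  assumes "0 < a"
  shows "is_core a p \<longleftrightarrow> is_partition p \<and> (\<forall>x\<in>beta p. a \<le> x \<longrightarrow> x - a \<in> beta p)"
proof -
  have "(\<forall>x\<in>X. \<forall>y<x. y \<notin> X \<longrightarrow> \<not> a dvd x - y) \<longleftrightarrow> (\<forall>x\<in>X. a \<le> x \<longrightarrow> x - a \<in> X)" for X :: "nat set"
  proof (intro iffI ballI allI impI notI)
    fix x assume *: "\<forall>x\<in>X. \<forall>y<x. y \<notin> X \<longrightarrow> \<not> a dvd x - y" "x \<in> X" "a \<le> x"
    show "x - a \<in> X"
    proof (rule ccontr)
      assume "x - a \<notin> X"
      moreover have "x - a < x" using * assms by auto
      ultimately have "\<not> a dvd x - (x - a)" using * by blast
      then show False using * by simp
    qed
  next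
    fix x y assume *: "\<forall>x\<in>X. a \<le> x \<longrightarrow> x - a \<in> X" "x \<in> X" "y < x" "y \<notin> X" "a dvd x - y"
    then obtain k where k: "x - y = k * a" by (auto simp: dvd_def mult.commute)
    then have "x - k * a \<in> X" using * closed_under_multiples[of X a x k] by fastforce
    moreover have "x - k * a = y" using k * by linarith
    ultimately show False using * by simp
  qed
  then show ?thesis
    unfolding is_core_def using hooks_iff_beta[of p "\<lambda>h. \<not> a dvd h"] by auto
qed

text \<open>Equivalently, the complement of \<open>X\<close> is cofinite, contains 0 and is closed
  under adding \<open>a\<close> and \<open>b\<close>.\<close>

definition core_sets :: "nat \<Rightarrow> nat \<Rightarrow> nat set set" where
  "core_sets a b = {X. finite X \<and> 0 \<notin> X \<and>
     (\<forall>x\<in>X. a \<le> x \<longrightarrow> x - a \<in> X) \<and> (\<forall>x\<in>X. b \<le> x \<longrightarrow> x - b \<in> X)}"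

lemma bij_betw_beta:
  assumes "0 < a" "0 < b"
  shows "bij_betw beta (core a b) (core_sets a b)"
proof (intro bij_betw_imageI)
  show "inj_on beta (core a b)"
    by (rule inj_on_subset[OF inj_on_beta]) (auto simp: core_def is_core_def)
  show "beta ` core a b = core_sets a b"
  proof
    show "beta ` core a b \<subseteq> core_sets a b"
      using zero_notin_beta by (auto simp: core_def core_sets_def is_core_iff_beta assms)
    show "core_sets a b \<subseteq> beta ` core a b"
    proof
      fix X assume X: "X \<in> core_sets a b"
      then obtain p where "is_partition p" "beta p = X"
        using beta_surj[of X] by (auto simp: core_sets_def)
      with X show "X \<in> beta ` core a b"
        by (intro image_eqI[of _ _ p]) (auto simp: core_def core_sets_def is_core_iff_beta assms)
    qed
  qed
qed

section \<open>Moments of random compositions\<close>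

definition compositions :: "nat \<Rightarrow> nat \<Rightarrow> nat list set" where
  "compositions a b = {z. length z = a \<and> sum_list z = b}"

lemma finite_compositions [simp]: "finite (compositions a b)"
proof (rule finite_subset)
  show "compositions a b \<subseteq> {z. set z \<subseteq> {..b} \<and> length z = a}"
    using member_le_sum_list by (auto simp: compositions_def)
qed (simp add: finite_lists_length_eq)

lemma sum_compositions_Suc:
  "(\<Sum>z\<in>compositions (Suc a) b. f z) = (\<Sum>m\<le>b. \<Sum>z\<in>compositions a (b - m). f (m # z))"
proof -
  have "compositions (Suc a) b
      = (\<lambda>(m, z). m # z) ` (SIGMA m:{..b}. compositions a (b - m))" (is "_ = ?h ` ?S")
    by (auto simp: compositions_def length_Suc_conv image_iff)
  moreover have "inj_on ?h ?S" by (auto intro: inj_onI)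
  ultimately show ?thesis
    by (simp add: sum.reindex sum.Sigma split_def)
qed

text \<open>Classify the subsets of \<open>{0..n}\<close> with \<open>k + l + 1\<close> elements by
  their element \<open>m\<close> that has exactly \<open>k\<close> smaller ones. The proof is by
  Pascal's rule on the second factor, with the hockey stick identity as the case
  \<open>l = 0\<close>.\<close>

lemma choose_convolution:
  "(\<Sum>m\<le>n. (m choose k) * ((n - m) choose l)) = Suc n choose (k + l + 1)"
proof (induction n arbitrary: l)
  case 0
  then show ?case by (cases k; cases l; simp)
next
  case (Suc n)
  show ?case
  proof (cases l)
    case 0
    then show ?thesis using sum_choose_upper[of k "Suc n"] by (simp add: atMost_atLeast0)
  next
    case (Suc l')
    \<comment> \<open>The term \<open>m = Suc n\<close> vanishes because \<open>l\<close> is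
      positive.\<close>
    have "(\<Sum>m\<le>Suc n. (m choose k) * ((Suc n - m) choose l))
      = (\<Sum>m\<le>n. (m choose k) * ((Suc n - m) choose l))"
      using Suc by simp
    also have "\<dots> = (\<Sum>m\<le>n. (m choose k) * ((n - m) choose l') + (m choose k) * ((n - m) choose l))"
      by (intro sum.cong refl) (simp add: Suc Suc_diff_le algebra_simps)
    also have "\<dots> = (Suc n choose (k + l' + 1)) + (Suc n choose (k + l + 1))"
      by (simp add: sum.distrib Suc.IH)
    also have "\<dots> = Suc (Suc n) choose (k + l + 1)"
      using Suc by simp
    finally show ?thesis .
  qed
qed

text \<open>In generating functions, each part contributes \<open>x^k / (1 - x)^(k + 1)\<close>, and
  the right side is the coefficient of \<open>x^b\<close> in the product. Here the first part is
  split off and the convolution applied.\<close>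

lemma sum_prod_choose_compositions:
  "(\<Sum>z\<in>compositions (Suc a) b. \<Prod>i<Suc a. (z ! i) choose k i)
    = (a + b) choose (a + (\<Sum>i<Suc a. k i))"
proof (induction a arbitrary: b k)
  case 0
  have "compositions (Suc 0) b = {[b]}"
    by (auto simp: compositions_def length_Suc_conv)
  then show ?case by simp
next
  case (Suc a)
  let ?K = "\<Sum>i<Suc a. k (Suc i)"
  have "(\<Sum>z\<in>compositions (Suc (Suc a)) b. \<Prod>i<Suc (Suc a). (z ! i) choose k i)
      = (\<Sum>m\<le>b. (m choose k 0) *
          (\<Sum>z\<in>compositions (Suc a) (b - m). \<Prod>i<Suc a. (z ! i) choose k (Suc i)))"
    by (simp add: sum_compositions_Suc[of _ "Suc a"] sum_distrib_left prod.lessThan_Suc_shift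
        del: prod.lessThan_Suc)
  also have "\<dots> = (\<Sum>m\<le>b. (m choose k 0) * ((a + b - m) choose (a + ?K)))"
    unfolding Suc.IH[where k = "\<lambda>i. k (Suc i)"] by (intro sum.cong) auto
  \<comment> \<open>For \<open>m > b\<close> the upper entry \<open>a + b - m\<close> drops below
    \<open>a\<close>, so the added terms are zero.\<close>
  also have "\<dots> = (\<Sum>m\<le>a + b. (m choose k 0) * ((a + b - m) choose (a + ?K)))"
    by (intro sum.mono_neutral_left) (auto simp: binomial_eq_0_iff)
  also have "\<dots> = Suc (a + b) choose (k 0 + (a + ?K) + 1)"
    by (rule choose_convolution)
  also have "k 0 + (a + ?K) + 1 = Suc a + (\<Sum>i<Suc (Suc a). k i)"
    by (simp add: sum.lessThan_Suc_shift del: sum.lessThan_Suc)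
  finally show ?case by simp
qed

text \<open>Extending \<open>k\<close> by 0 outside \<open>S\<close> only inserts factors
  \<open>_ choose 0 = 1\<close>.\<close>

lemma sum_prod_choose_compositions_subset:
  assumes "S \<subseteq> {..n}"
  shows "(\<Sum>z\<in>compositions (Suc n) b. \<Prod>i\<in>S. real ((z ! i) choose k i))
    = real ((n + b) choose (n + (\<Sum>i\<in>S. k i)))"
proof -
  let ?k = "\<lambda>i. if i \<in> S then k i else 0"
  have "(\<Prod>i\<in>S. real ((z ! i) choose k i)) = real (\<Prod>i<Suc n. (z ! i) choose ?k i)" for z
    unfolding of_nat_prod using assms by (intro prod.mono_neutral_cong_left) auto
  moreover have "(\<Sum>i<Suc n. ?k i) = (\<Sum>i\<in>S. k i)"
    using assms by (intro sum.mono_neutral_cong_right) auto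
  ultimately show ?thesis
    by (simp only: of_nat_sum[symmetric] sum_prod_choose_compositions)
qed

lemma sum_if_const:
  "(\<Sum>x\<in>A. if P then f x else 0) = (if P then \<Sum>x\<in>A. f x else (0::'a::comm_monoid_add))"
  by simp

lemma square_eq_choose_two: "real x ^ 2 = 2 * real (x choose 2) + real x"
  by (induction x) (auto simp: numeral_2_eq_2 algebra_simps)

section \<open>Second and fourth mixed moments, with \<open>B K\<close> the total of any product of
  binomials in distinct parts whose lower entries add up to \<open>K\<close>\<close>

context
  fixes n b :: nat and B :: "nat \<Rightarrow> real"
  defines "B \<equiv> \<lambda>K. real ((n + b) choose (n + K))"
begin

lemma compositions_moment_2:
  assumes "i \<le> n" "j \<le> n" "i \<noteq> j"
  shows "(\<Sum>z\<in>compositions (Suc n) b. real (z ! i) * real (z ! j)) = B 2"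
  using sum_prod_choose_compositions_subset[of "{i, j}" n "\<lambda>_. 1" b] assms
  by (simp add: B_def numeral_2_eq_2)

text \<open>As \<open>i\<close> differs from \<open>j\<close> and \<open>k\<close> from
  \<open>l\<close>, parts occur at most squared, and \<open>x^2 = 2 * (x choose 2) + x\<close>
  reduces everything to values of \<open>B\<close>: no coincidence gives \<open>B 4\<close>, one
  gives \<open>2 * B 4 + B 3\<close>, two give \<open>4 * B 4 + 4 * B 3 + B 2\<close>. The last
  summand corrects for double coincidences.\<close>

lemma compositions_moment_4:
  assumes "i \<le> n" "j \<le> n" "i \<noteq> j" "k \<le> n" "l \<le> n" "k \<noteq> l"
  shows "(\<Sum>z\<in>compositions (Suc n) b. real (z ! i) * real (z ! j) * (real (z ! k) * real (z ! l)))
    = B 4 + (B 4 + B 3) * (of_bool (i = k) + of_bool (i = l) + of_bool (j = k) + of_bool (j = l))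
      + (B 4 + 2 * B 3 + B 2) * (of_bool (i = k \<and> j = l) + of_bool (i = l \<and> j = k))"
proof -
  let ?C = "compositions (Suc n) b"
  have m211: "(\<Sum>z\<in>?C. real (z ! i) ^ 2 * real (z ! j) * real (z ! k)) = 2 * B 4 + B 3"
    if "i \<le> n" "j \<le> n" "k \<le> n" "i \<noteq> j" "i \<noteq> k" "j \<noteq> k" for i j k
  proof -
    have "(\<Sum>z\<in>?C. real (z ! i choose 2) * real (z ! j) * real (z ! k)) = B 4"
      using sum_prod_choose_compositions_subset[of "{i, j, k}" n "\<lambda>m. if m = i then 2 else 1" b] that
      by (simp add: B_def mult.assoc)
    moreover have "(\<Sum>z\<in>?C. real (z ! i) * real (z ! j) * real (z ! k)) = B 3"
      using sum_prod_choose_compositions_subset[of "{i, j, k}" n "\<lambda>_. 1" b] that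
      by (simp add: B_def mult.assoc numeral_3_eq_3)
    ultimately show ?thesis
      by (simp add: square_eq_choose_two distrib_right sum.distrib mult.assoc flip: sum_distrib_left)
  qed
  have m22: "(\<Sum>z\<in>?C. real (z ! i) ^ 2 * real (z ! j) ^ 2) = 4 * B 4 + 4 * B 3 + B 2"
    if "i \<le> n" "j \<le> n" "i \<noteq> j" for i j
  proof -
    have "(\<Sum>z\<in>?C. real (z ! i choose 2) * real (z ! j choose 2)) = B 4"
      using sum_prod_choose_compositions_subset[of "{i, j}" n "\<lambda>_. 2" b] that
      by (simp add: B_def)
    moreover have "(\<Sum>z\<in>?C. real (z ! i choose 2) * real (z ! j)) = B 3"
      if "i \<le> n" "j \<le> n" "i \<noteq> j" for i j
      using sum_prod_choose_compositions_subset[of "{i, j}" n "\<lambda>m. if m = i then 2 else 1" b] that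
      by (simp add: B_def)
    from this[of i j] this[of j i] have
      "(\<Sum>z\<in>?C. real (z ! i choose 2) * real (z ! j)) = B 3"
      "(\<Sum>z\<in>?C. real (z ! i) * real (z ! j choose 2)) = B 3"
      using that by (simp_all add: mult.commute)
    moreover have "(\<Sum>z\<in>?C. real (z ! i) ^ 2 * real (z ! j) ^ 2)
        = 4 * (\<Sum>z\<in>?C. real (z ! i choose 2) * real (z ! j choose 2))
        + 2 * (\<Sum>z\<in>?C. real (z ! i choose 2) * real (z ! j))
        + 2 * (\<Sum>z\<in>?C. real (z ! i) * real (z ! j choose 2))
        + (\<Sum>z\<in>?C. real (z ! i) * real (z ! j))"
      unfolding sum_distrib_left sum.distrib[symmetric] square_eq_choose_two
      by (intro sum.cong refl) (simp add: algebra_simps)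
    ultimately show ?thesis
      using compositions_moment_2[OF that] by simp
  qed
  consider "i = k" "j = l" | "i = l" "j = k"
    | "i = k" "j \<noteq> l" | "i = l" "j \<noteq> k" | "j = k" "i \<noteq> l" | "j = l" "i \<noteq> k"
    | "i \<noteq> k" "i \<noteq> l" "j \<noteq> k" "j \<noteq> l" by blast
  then show ?thesis
  proof cases
    case 1
    then show ?thesis using m22[of i j] assms by (simp add: power2_eq_square mult_ac)
  next
    case 2
    then show ?thesis using m22[of i j] assms by (simp add: power2_eq_square mult_ac)
  next
    case 3
    then show ?thesis using m211[of i j l] assms by (simp add: power2_eq_square mult_ac)
  next
    case 4
    then show ?thesis using m211[of i j k] assms by (simp add: power2_eq_square mult_ac)
  next
    case 5
    then show ?thesis using m211[of j i l] assms by (simp add: power2_eq_square mult_ac)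
  next
    case 6
    then show ?thesis using m211[of j i k] assms by (simp add: power2_eq_square mult_ac)
  next
    case 7
    then show ?thesis
      using sum_prod_choose_compositions_subset[of "{i, j, k, l}" n "\<lambda>_. 1" b] assms
      by (simp add: B_def mult.assoc numeral_eq_Suc)
  qed
qed

context
  fixes G :: "nat \<Rightarrow> nat \<Rightarrow> real"
  assumes G_diag: "\<And>i. G i i = 0"
begin

text \<open>The zero diagonal removes the terms \<open>i = j\<close>, and all others have the same
  moment \<open>B 2\<close>.\<close>

lemma sum_quadratic_form_compositions:
  "(\<Sum>z\<in>compositions (Suc n) b. \<Sum>i\<le>n. \<Sum>j\<le>n. G i j * (real (z ! i) * real (z ! j)))
    = B 2 * (\<Sum>i\<le>n. \<Sum>j\<le>n. G i j)" (is "?L = _")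
proof -
  have "?L = (\<Sum>i\<le>n. \<Sum>j\<le>n. G i j * (\<Sum>z\<in>compositions (Suc n) b. real (z ! i) * real (z ! j)))"
    by (subst sum.swap, intro sum.cong refl, subst sum.swap) (simp add: sum_distrib_left)
  also have "\<dots> = (\<Sum>i\<le>n. \<Sum>j\<le>n. B 2 * G i j)"
  proof (intro sum.cong refl)
    fix i j assume "i \<in> {..n}" "j \<in> {..n}"
    then show "G i j * (\<Sum>z\<in>compositions (Suc n) b. real (z ! i) * real (z ! j)) = B 2 * G i j"
      using compositions_moment_2[of i j] G_diag by (cases "i = j") auto
  qed
  finally show ?thesis by (simp add: sum_distrib_left)
qed

text \<open>The square is a sum over four indices. By symmetry each of the four single coincidences
  collapses to the sum of squared row sums, and each of the two double ones to the sum of squared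
  entries.\<close>

lemma sum_quadratic_form_squared_compositions:
  assumes G_sym: "\<And>i j. G i j = G j i"
  shows "(\<Sum>z\<in>compositions (Suc n) b. (\<Sum>i\<le>n. \<Sum>j\<le>n. G i j * (real (z ! i) * real (z ! j)))\<^sup>2)
    = B 4 * (\<Sum>i\<le>n. \<Sum>j\<le>n. G i j)\<^sup>2 + 4 * (B 4 + B 3) * (\<Sum>i\<le>n. (\<Sum>j\<le>n. G i j)\<^sup>2)
      + 2 * (B 4 + 2 * B 3 + B 2) * (\<Sum>i\<le>n. \<Sum>j\<le>n. (G i j)\<^sup>2)" (is "?L = _")
proof -
  let ?C = "compositions (Suc n) b"
  let ?\<alpha> = "B 4 + B 3" and ?\<beta> = "B 4 + 2 * B 3 + B 2"
  have "?L = (\<Sum>z\<in>?C. \<Sum>i\<le>n. \<Sum>j\<le>n. \<Sum>k\<le>n. \<Sum>l\<le>n.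
      G i j * G k l * (real (z ! i) * real (z ! j) * (real (z ! k) * real (z ! l))))"
    unfolding power2_eq_square sum_distrib_left sum_distrib_right
    by (subst (2) sum.swap, subst (3) sum.swap) (intro sum.cong refl, simp add: mult_ac)
  also have "\<dots> = (\<Sum>i\<le>n. \<Sum>j\<le>n. \<Sum>k\<le>n. \<Sum>l\<le>n. G i j * G k l *
      (\<Sum>z\<in>?C. real (z ! i) * real (z ! j) * (real (z ! k) * real (z ! l))))"
    unfolding sum_distrib_left
    by (subst sum.swap, intro sum.cong refl, subst sum.swap, intro sum.cong refl,
        subst sum.swap, intro sum.cong refl, subst sum.swap, intro sum.cong refl)
  also have "\<dots> = (\<Sum>i\<le>n. \<Sum>j\<le>n. \<Sum>k\<le>n. \<Sum>l\<le>n. B 4 * (G i j * G k l)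
      + ?\<alpha> * (if i = k then G i j * G k l else 0) + ?\<alpha> * (if i = l then G i j * G k l else 0)
      + ?\<alpha> * (if j = k then G i j * G k l else 0) + ?\<alpha> * (if j = l then G i j * G k l else 0)
      + ?\<beta> * (if i = k then if j = l then G i j * G k l else 0 else 0)
      + ?\<beta> * (if i = l then if j = k then G i j * G k l else 0 else 0))"
  proof (intro sum.cong refl)
    fix i j k l assume *: "i \<in> {..n}" "j \<in> {..n}" "k \<in> {..n}" "l \<in> {..n}"
    show "G i j * G k l * (\<Sum>z\<in>?C. real (z ! i) * real (z ! j) * (real (z ! k) * real (z ! l)))
      = B 4 * (G i j * G k l)
      + ?\<alpha> * (if i = k then G i j * G k l else 0) + ?\<alpha> * (if i = l then G i j * G k l else 0)
      + ?\<alpha> * (if j = k then G i j * G k l else 0) + ?\<alpha> * (if j = l then G i j * G k l else 0)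
      + ?\<beta> * (if i = k then if j = l then G i j * G k l else 0 else 0)
      + ?\<beta> * (if i = l then if j = k then G i j * G k l else 0 else 0)"
    \<comment> \<open>The index patterns not covered by the moment formula carry a diagonal factor
      of \<open>G\<close>, which is zero.\<close>
    proof (cases "i = j \<or> k = l")
      case True
      then show ?thesis using G_diag by auto
    next
      case False
      then show ?thesis
        using * by (subst compositions_moment_4) (auto simp: algebra_simps)
    qed
  qed
  also have "\<dots> = B 4 * (\<Sum>i\<le>n. \<Sum>j\<le>n. \<Sum>k\<le>n. \<Sum>l\<le>n. G i j * G k l)
      + ?\<alpha> * (\<Sum>i\<le>n. \<Sum>j\<le>n. \<Sum>k\<le>n. \<Sum>l\<le>n. if i = k then G i j * G k l else 0)
      + ?\<alpha> * (\<Sum>i\<le>n. \<Sum>j\<le>n. \<Sum>k\<le>n. \<Sum>l\<le>n. if i = l then G i j * G k l else 0)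
      + ?\<alpha> * (\<Sum>i\<le>n. \<Sum>j\<le>n. \<Sum>k\<le>n. \<Sum>l\<le>n. if j = k then G i j * G k l else 0)
      + ?\<alpha> * (\<Sum>i\<le>n. \<Sum>j\<le>n. \<Sum>k\<le>n. \<Sum>l\<le>n. if j = l then G i j * G k l else 0)
      + ?\<beta> * (\<Sum>i\<le>n. \<Sum>j\<le>n. \<Sum>k\<le>n. \<Sum>l\<le>n. if i = k then if j = l then G i j * G k l else 0 else 0)
      + ?\<beta> * (\<Sum>i\<le>n. \<Sum>j\<le>n. \<Sum>k\<le>n. \<Sum>l\<le>n. if i = l then if j = k then G i j * G k l else 0 else 0)"
    unfolding sum.distrib sum_distrib_left ..
  also have "(\<Sum>i\<le>n. \<Sum>j\<le>n. \<Sum>k\<le>n. \<Sum>l\<le>n. G i j * G k l) = (\<Sum>i\<le>n. \<Sum>j\<le>n. G i j)\<^sup>2"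
    unfolding power2_eq_square sum_distrib_left sum_distrib_right
    by (subst (2) sum.swap, subst (3) sum.swap) (intro sum.cong refl, simp add: mult_ac)
  also have "(\<Sum>i\<le>n. \<Sum>j\<le>n. \<Sum>k\<le>n. \<Sum>l\<le>n. if i = k then G i j * G k l else 0)
      = (\<Sum>i\<le>n. (\<Sum>j\<le>n. G i j)\<^sup>2)"
    by (simp add: sum_if_const power2_eq_square sum_product)
  also have "(\<Sum>i\<le>n. \<Sum>j\<le>n. \<Sum>k\<le>n. \<Sum>l\<le>n. if i = l then G i j * G k l else 0)
      = (\<Sum>i\<le>n. (\<Sum>j\<le>n. G i j)\<^sup>2)"
    unfolding power2_eq_square sum_product
    by (intro sum.cong refl) (simp add: sum_if_const G_sym)
  also have "(\<Sum>i\<le>n. \<Sum>j\<le>n. \<Sum>k\<le>n. \<Sum>l\<le>n. if j = k then G i j * G k l else 0)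
      = (\<Sum>i\<le>n. (\<Sum>j\<le>n. G i j)\<^sup>2)"
    by (subst sum.swap) (simp add: sum_if_const power2_eq_square sum_product G_sym)
  also have "(\<Sum>i\<le>n. \<Sum>j\<le>n. \<Sum>k\<le>n. \<Sum>l\<le>n. if j = l then G i j * G k l else 0)
      = (\<Sum>i\<le>n. (\<Sum>j\<le>n. G i j)\<^sup>2)"
    unfolding power2_eq_square sum_product
    by (subst sum.swap) (intro sum.cong refl, simp add: sum_if_const G_sym)
  also have "(\<Sum>i\<le>n. \<Sum>j\<le>n. \<Sum>k\<le>n. \<Sum>l\<le>n. if i = k then if j = l then G i j * G k l else 0 else 0)
      = (\<Sum>i\<le>n. \<Sum>j\<le>n. (G i j)\<^sup>2)"
    by (simp add: sum_if_const power2_eq_square)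
  also have "(\<Sum>i\<le>n. \<Sum>j\<le>n. \<Sum>k\<le>n. \<Sum>l\<le>n. if i = l then if j = k then G i j * G k l else 0 else 0)
      = (\<Sum>i\<le>n. \<Sum>j\<le>n. (G i j)\<^sup>2)"
    by (intro sum.cong refl) (simp add: sum_if_const power2_eq_square, simp add: G_sym)
  finally show ?thesis by (simp add: algebra_simps)
qed

end

end

section \<open>A rotation invariant quadratic form\<close>

lemma sum_real_lessThan: "(\<Sum>k<n. real k) = real n * (real n - 1) / 2"
  by (induction n) (auto simp: field_simps)

text \<open>The product of the two arc lengths between \<open>i\<close> and \<open>j\<close> on a
  cycle of \<open>a\<close> points; hence its invariance under rotation, where a wrap-around merely
  exchanges the arcs.\<close>

definition circ :: "nat \<Rightarrow> nat \<Rightarrow> nat \<Rightarrow> real" where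
  "circ a i j = \<bar>real i - real j\<bar> * (real a - \<bar>real i - real j\<bar>)"

lemma circ_diag: "circ a i i = 0"
  by (simp add: circ_def)

lemma circ_sym: "circ a i j = circ a j i"
  by (simp add: circ_def abs_minus_commute)

lemma circ_Suc_mod:
  assumes "i < a" "j < a"
  shows "circ a (Suc i mod a) (Suc j mod a) = circ a i j"
  using assms by (cases "Suc i = a"; cases "Suc j = a") (auto simp: circ_def)

text \<open>Indices \<open>j \<ge> i\<close> have the distances \<open>0\<close> to
  \<open>a - i - 1\<close>; those below \<open>i\<close> have the distances \<open>1\<close> to
  \<open>i\<close>, which the reflection \<open>x \<mapsto> a - x\<close> turns into the missing
  \<open>a - i\<close> to \<open>a - 1\<close>.\<close>

lemma sum_circular_distance:
  fixes F :: "real \<Rightarrow> real"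
  assumes "i < a" and F: "\<And>x. F (real a - x) = F x"
  shows "(\<Sum>j<a. F \<bar>real i - real j\<bar>) = (\<Sum>d<a. F (real d))"
proof -
  have "(\<Sum>j<a. F \<bar>real i - real j\<bar>) = (\<Sum>j<i. F \<bar>real i - real j\<bar>) + (\<Sum>j=i..<a. F \<bar>real i - real j\<bar>)"
    using assms(1) by (subst sum.union_disjoint[symmetric]) (auto intro: sum.cong)
  also have "(\<Sum>j<i. F \<bar>real i - real j\<bar>) = (\<Sum>d=a-i..<a. F (real d))"
  proof (rule sum.reindex_bij_witness[of _ "\<lambda>d. d - (a - i)" "\<lambda>j. j + (a - i)"])
    fix j assume "j \<in> {..<i}"
    then have "real (j + (a - i)) = real a - \<bar>real i - real j\<bar>"
      using assms(1) by auto
    then show "F (real (j + (a - i))) = F \<bar>real i - real j\<bar>" by (simp only: F)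
  qed (use assms(1) in auto)
  also have "(\<Sum>j=i..<a. F \<bar>real i - real j\<bar>) = (\<Sum>d<a-i. F (real d))"
    by (rule sum.reindex_bij_witness[of _ "\<lambda>d. d + i" "\<lambda>j. j - i"]) (auto simp: of_nat_diff)
  also have "(\<Sum>d=a-i..<a. F (real d)) + (\<Sum>d<a-i. F (real d)) = (\<Sum>d<a. F (real d))"
    by (subst sum.union_disjoint[symmetric]) (auto intro: sum.cong)
  finally show ?thesis .
qed

lemma sum_circ:
  assumes "i < a"
  shows "(\<Sum>j<a. circ a i j) = real a * (real a ^ 2 - 1) / 6"
proof -
  have "(\<Sum>j<a. circ a i j) = (\<Sum>d<a. real d * (real a - real d))"
    unfolding circ_def using assms
    by (intro sum_circular_distance[where F = "\<lambda>x. x * (real a - x)"]) (auto simp: algebra_simps)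
  \<comment> \<open>The coefficient \<open>c\<close> is separated from the bound \<open>n\<close> so
    that induction on \<open>n\<close> is possible; both are then set to \<open>a\<close>.\<close>
  also have "(\<Sum>d<n. real d * (c - real d))
      = c * (real n * (real n - 1) / 2) - real n * (real n - 1) * (2 * real n - 1) / 6" for c n
    by (induction n) (auto simp: field_simps)
  finally show ?thesis by (simp add: field_simps power2_eq_square)
qed

lemma sum_circ_squared:
  assumes "i < a"
  shows "(\<Sum>j<a. (circ a i j)\<^sup>2) = real a * (real a ^ 4 - 1) / 30"
proof -
  have "(\<Sum>j<a. (circ a i j)\<^sup>2) = (\<Sum>d<a. (real d * (real a - real d))\<^sup>2)"
    unfolding circ_def using assms
    by (intro sum_circular_distance[where F = "\<lambda>x. (x * (real a - x))\<^sup>2"]) (auto simp: mult.commute)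
  also have "(\<Sum>d<n. (real d * (c - real d))\<^sup>2)
      = c\<^sup>2 * (real n * (real n - 1) * (2 * real n - 1) / 6) - 2 * c * (real n * (real n - 1) / 2)\<^sup>2
        + real n * (real n - 1) * (2 * real n - 1) * (3 * (real n)\<^sup>2 - 3 * real n - 1) / 30" for c n
    by (induction n) (auto simp: field_simps power2_eq_square)
  finally show ?thesis by (simp add: field_simps power2_eq_square power4_eq_xxxx)
qed

definition quad :: "nat list \<Rightarrow> real" where
  "quad z = (\<Sum>i<length z. \<Sum>j<length z. circ (length z) i j * (real (z ! i) * real (z ! j)))"

text \<open>Rotation shifts both indices by one modulo the length, which preserves
  \<open>circ\<close> and permutes the index range.\<close>

lemma quad_rotate1: "quad (rotate1 z) = quad z"
proof -
  let ?a = "length z"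
  let ?F = "\<lambda>i j. circ ?a i j * (real (z ! i) * real (z ! j))"
  have bij: "bij_betw (\<lambda>i. Suc i mod ?a) {..<?a} {..<?a}"
  proof (rule bij_betw_byWitness[where f' = "\<lambda>i. if i = 0 then ?a - 1 else i - 1"])
    show "\<forall>i\<in>{..<?a}. (if Suc i mod ?a = 0 then ?a - 1 else Suc i mod ?a - 1) = i"
      by (auto simp: mod_Suc)
    show "\<forall>i\<in>{..<?a}. Suc (if i = 0 then ?a - 1 else i - 1) mod ?a = i"
      by auto
  qed (auto intro!: mod_less_divisor)
  have "quad (rotate1 z) = (\<Sum>i<?a. \<Sum>j<?a. ?F (Suc i mod ?a) (Suc j mod ?a))"
    unfolding quad_def by (auto intro!: sum.cong simp: nth_rotate1 circ_Suc_mod)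
  also have "\<dots> = (\<Sum>i<?a. \<Sum>j<?a. ?F (Suc i mod ?a) j)"
    by (intro sum.cong refl sum.reindex_bij_betw[OF bij])
  also have "\<dots> = quad z"
    unfolding quad_def by (rule sum.reindex_bij_betw[OF bij])
  finally show ?thesis .
qed

lemma quad_rotate: "quad (rotate k z) = quad z"
  by (induction k) (auto simp: quad_rotate1)

text \<open>Terms linear in \<open>w\<close> become quadratic upon substituting \<open>b = (\<Sum>i<a. w i)\<close>.\<close>

lemma variance_heights_eq_circ:
  fixes w :: "nat \<Rightarrow> real" and a :: nat
  defines "b \<equiv> \<Sum>i<a. w i" and "Z \<equiv> \<lambda>j. \<Sum>i<j. w i"
  shows "real a * (\<Sum>j<a. (real j * b - real a * Z j)\<^sup>2) - (\<Sum>j<a. real j * b - real a * Z j)\<^sup>2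
    = b\<^sup>2 * (real a * (\<Sum>j<a. real j ^ 2) - (\<Sum>j<a. real j)\<^sup>2)
      - (real a)\<^sup>2 / 2 * (\<Sum>i<a. \<Sum>l<a. circ a i l * (w i * w l))"
proof -
  define D where "D c = (\<Sum>i<a. \<Sum>l<a. c i l * (w i * w l))" for c
  \<comment> \<open>A quadratic form depends only on the symmetric part of its coefficients.\<close>
  have sym: "D (\<lambda>i l. c i) = D (\<lambda>i l. (c i + c l) / 2)" for c
  proof -
    have "D (\<lambda>i l. c l) = D (\<lambda>i l. c i)"
      unfolding D_def by (subst sum.swap) (simp add: mult.commute)
    then have "D (\<lambda>i l. c i) = (D (\<lambda>i l. c i) + D (\<lambda>i l. c l)) / 2" by simp
    also have "\<dots> = D (\<lambda>i l. (c i + c l) / 2)"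
      unfolding D_def by (simp add: sum.distrib sum_divide_distrib add_divide_distrib distrib_right)
    finally show ?thesis .
  qed
  have Z: "Z j = (\<Sum>i<a. w i * of_bool (i < j))" if "j < a" for j
    unfolding Z_def using that by (intro sum.mono_neutral_cong_left) auto
  have tail1: "(\<Sum>j<n. of_bool (i < j)) = real n - 1 - real i" if "i < n" for i n
    using that by (induction n) (auto simp: less_Suc_eq)
  have tail2: "(\<Sum>j<n. real j * of_bool (i < j)) = real n * (real n - 1) / 2 - real i * (real i + 1) / 2"
    if "i < n" for i n
  proof -
    have "{..<i} \<inter> Collect ((<) i) = {}" by auto
    then show ?thesis
      using that by (induction n) (auto simp: less_Suc_eq field_simps sum_real_lessThan)
  qed
  have SZ: "(\<Sum>j<a. Z j) = (\<Sum>i<a. w i * (real a - 1 - real i))"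
  proof -
    have "(\<Sum>j<a. Z j) = (\<Sum>i<a. w i * (\<Sum>j<a. of_bool (i < j)))"
      unfolding sum_distrib_left by (subst sum.swap) (simp add: Z)
    also have "\<dots> = (\<Sum>i<a. w i * (real a - 1 - real i))"
      by (intro sum.cong refl) (subst tail1, auto)
    finally show ?thesis .
  qed
  have SjZ: "(\<Sum>j<a. real j * Z j)
      = (\<Sum>i<a. w i * (real a * (real a - 1) / 2 - real i * (real i + 1) / 2))"
  proof -
    have "(\<Sum>j<a. real j * Z j) = (\<Sum>i<a. w i * (\<Sum>j<a. real j * of_bool (i < j)))"
      unfolding sum_distrib_left
      by (subst sum.swap, intro sum.cong refl) (simp only: Z lessThan_iff sum_distrib_left mult_ac)
    also have "\<dots> = (\<Sum>i<a. w i * (real a * (real a - 1) / 2 - real i * (real i + 1) / 2))"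
      by (intro sum.cong refl) (subst tail2, auto)
    finally show ?thesis .
  qed
  have SZ2: "(\<Sum>j<a. (Z j)\<^sup>2) = D (\<lambda>i l. real a - 1 - max (real i) (real l))"
  proof -
    \<comment> \<open>The conditions \<open>i < j\<close> and \<open>l < j\<close> merge into
      \<open>max i l < j\<close>, so \<open>tail1\<close> counts the admissible
      \<open>j\<close>.\<close>
    have "(\<Sum>j<a. (Z j)\<^sup>2) = (\<Sum>j<a. \<Sum>i<a. \<Sum>l<a. of_bool (max i l < j) * (w i * w l))"
      unfolding power2_eq_square
    proof (intro sum.cong refl)
      fix j assume "j \<in> {..<a}"
      then have "Z j = (\<Sum>i<a. w i * of_bool (i < j))" by (simp only: Z lessThan_iff)
      then have "Z j * Z j = (\<Sum>i<a. \<Sum>l<a. w i * of_bool (i < j) * (w l * of_bool (l < j)))"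
        by (simp only: sum_product)
      also have "\<dots> = (\<Sum>i<a. \<Sum>l<a. of_bool (max i l < j) * (w i * w l))"
        by (intro sum.cong refl) (simp add: of_bool_def)
      finally show "Z j * Z j = (\<Sum>i<a. \<Sum>l<a. of_bool (max i l < j) * (w i * w l))" .
    qed
    also have "\<dots> = (\<Sum>i<a. \<Sum>l<a. (\<Sum>j<a. of_bool (max i l < j)) * (w i * w l))"
      unfolding sum_distrib_right
      by (subst sum.swap, rule sum.cong[OF refl], rule sum.swap)
    also have "\<dots> = D (\<lambda>i l. real a - 1 - max (real i) (real l))"
      unfolding D_def by (intro sum.cong refl) (subst tail1, auto)
    finally show ?thesis .
  qed
  have bSZ: "b * (\<Sum>j<a. Z j) = D (\<lambda>i l. real a - 1 - (real i + real l) / 2)"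
  proof -
    have "b * (\<Sum>j<a. Z j) = D (\<lambda>i l. real a - 1 - real i)"
      unfolding SZ b_def D_def
      by (subst mult.commute, subst sum_product) (intro sum.cong refl, simp add: mult_ac)
    also have "\<dots> = D (\<lambda>i l. real a - 1 - (real i + real l) / 2)"
      by (subst sym) (intro arg_cong[of _ _ D] ext, simp add: field_simps)
    finally show ?thesis .
  qed
  have bSjZ: "b * (\<Sum>j<a. real j * Z j)
      = D (\<lambda>i l. real a * (real a - 1) / 2 - (real i * (real i + 1) + real l * (real l + 1)) / 4)"
  proof -
    have "b * (\<Sum>j<a. real j * Z j) = D (\<lambda>i l. real a * (real a - 1) / 2 - real i * (real i + 1) / 2)"
      unfolding SjZ b_def D_def
      by (subst mult.commute, subst sum_product) (intro sum.cong refl, simp add: mult_ac)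
    also have "\<dots> = D (\<lambda>i l. real a * (real a - 1) / 2 - (real i * (real i + 1) + real l * (real l + 1)) / 4)"
      by (subst sym) (intro arg_cong[of _ _ D] ext, simp add: field_simps)
    finally show ?thesis .
  qed
  have SZSZ: "(\<Sum>j<a. Z j)\<^sup>2 = D (\<lambda>i l. (real a - 1 - real i) * (real a - 1 - real l))"
    unfolding SZ D_def power2_eq_square by (simp add: sum_product mult_ac)
  \<comment> \<open>All four terms are now forms \<open>D\<close>, so it suffices to compare the
    coefficients of \<open>w i * w l\<close>; there \<open>max\<close> and the absolute value in
    \<open>circ\<close> are resolved by the order of \<open>i\<close> and \<open>l\<close>.\<close>
  have main: "- 2 * (b * (\<Sum>j<a. real j * Z j)) + real a * (\<Sum>j<a. (Z j)\<^sup>2)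
      + (real a - 1) * (b * (\<Sum>j<a. Z j)) - (\<Sum>j<a. Z j)\<^sup>2 = - 1 / 2 * D (circ a)"
    unfolding SZ2 bSZ bSjZ SZSZ
    unfolding D_def sum_distrib_left sum.distrib[symmetric] sum_subtractf[symmetric]
  proof (intro sum.cong refl)
    fix i l
    have "- 2 * (real a * (real a - 1) / 2 - (real i * (real i + 1) + real l * (real l + 1)) / 4)
      + real a * (real a - 1 - max (real i) (real l))
      + (real a - 1) * (real a - 1 - (real i + real l) / 2)
      - (real a - 1 - real i) * (real a - 1 - real l) = - 1 / 2 * circ a i l" (is "?x = ?y")
      by (cases "i \<le> l") (auto simp: circ_def max_def field_simps)
    then have "?x * (w i * w l) = ?y * (w i * w l)" by simp
    then show "- 2 * ((real a * (real a - 1) / 2 - (real i * (real i + 1) + real l * (real l + 1)) / 4) * (w i * w l))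
      + real a * ((real a - 1 - max (real i) (real l)) * (w i * w l))
      + (real a - 1) * ((real a - 1 - (real i + real l) / 2) * (w i * w l))
      - (real a - 1 - real i) * (real a - 1 - real l) * (w i * w l) = - 1 / 2 * (circ a i l * (w i * w l))"
      by (simp only: distrib_right left_diff_distrib mult.assoc)
  qed
  have lin: "(\<Sum>j<a. real j * b - real a * Z j) = b * (\<Sum>j<a. real j) - real a * (\<Sum>j<a. Z j)"
    by (simp add: sum_subtractf sum_distrib_left mult.commute)
  have sq: "(\<Sum>j<a. (real j * b - real a * Z j)\<^sup>2)
      = b\<^sup>2 * (\<Sum>j<a. real j ^ 2) - 2 * real a * b * (\<Sum>j<a. real j * Z j) + (real a)\<^sup>2 * (\<Sum>j<a. (Z j)\<^sup>2)"
    unfolding sum_distrib_left sum.distrib[symmetric] sum_subtractf[symmetric]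
    by (intro sum.cong refl) (simp add: power2_eq_square algebra_simps)
  \<comment> \<open>The coefficient \<open>real a - 1\<close> stems from the cross term of the
    squared sum, where \<open>2 * (\<Sum>j<a. real j) = a * (a - 1)\<close>.\<close>
  have "real a * (\<Sum>j<a. (real j * b - real a * Z j)\<^sup>2) - (\<Sum>j<a. real j * b - real a * Z j)\<^sup>2
    = b\<^sup>2 * (real a * (\<Sum>j<a. real j ^ 2) - (\<Sum>j<a. real j)\<^sup>2)
      + (real a)\<^sup>2 * (- 2 * (b * (\<Sum>j<a. real j * Z j)) + real a * (\<Sum>j<a. (Z j)\<^sup>2)
      + (real a - 1) * (b * (\<Sum>j<a. Z j)) - (\<Sum>j<a. Z j)\<^sup>2)"
    unfolding lin sq sum_real_lessThan by (simp add: power2_eq_square field_simps)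
  then show ?thesis
    unfolding main by (simp add: D_def)
qed

section \<open>The cycle lemma\<close>

text \<open>Lattice paths whose partial sums stay weakly below the line of slope
  \<open>b / a\<close>.\<close>

definition dyck :: "nat \<Rightarrow> nat \<Rightarrow> nat list set" where
  "dyck a b = {z \<in> compositions a b. \<forall>j\<le>a. a * sum_list (take j z) \<le> j * b}"

lemma sum_list_take_drop: "sum_list (take m z) + sum_list (drop m z) = sum_list (z :: nat list)"
  by (metis append_take_drop_id sum_list_append)

lemma rotate_in_compositions: "z \<in> compositions a b \<Longrightarrow> rotate k z \<in> compositions a b"
proof -
  have "sum_list (rotate1 z) = sum_list z" for z :: "nat list"
    by (cases z) auto
  then have "sum_list (rotate k z) = sum_list z" for z :: "nat list"
    by (induction k) auto
  then show "z \<in> compositions a b \<Longrightarrow> rotate k z \<in> compositions a b"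
    by (simp add: compositions_def)
qed

text \<open>The two Dyck conditions at the cut bound the sums before and after it, and these bounds
  add up to the total. So the path meets the line at \<open>m\<close>, giving
  \<open>a dvd m * b\<close> and by coprimality \<open>a dvd m\<close>.\<close>

lemma dyck_rotate_unique:
  assumes "coprime a b" "z \<in> dyck a b" "rotate m z \<in> dyck a b" "m < a"
  shows "m = 0"
proof -
  have len: "length z = a" and sum: "sum_list z = b"
    using assms(2) by (auto simp: dyck_def compositions_def)
  have "rotate m z = drop m z @ take m z"
    using assms(4) len by (simp add: rotate_drop_take)
  then have "a * sum_list (drop m z) \<le> (a - m) * b"
    using assms(3,4) len unfolding dyck_def by (auto dest!: spec[of _ "a - m"])
  moreover have "a * sum_list (take m z) \<le> m * b"
    using assms(2,4) unfolding dyck_def by auto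
  moreover have "a * sum_list (take m z) + a * sum_list (drop m z) = a * b"
    using sum_list_take_drop[of m z] sum by (simp flip: distrib_left)
  moreover have "(a - m) * b + m * b = a * b"
    using assms(4) by (simp flip: distrib_right)
  ultimately have "m * b = a * sum_list (take m z)" by linarith
  then have "a dvd m * b" by simp
  then have "a dvd m" using assms(1) by (simp add: coprime_dvd_mult_left_iff)
  then show ?thesis using assms(4) by (auto dest: dvd_imp_le)
qed

text \<open>Cut at a minimum of the height \<open>u\<close>: measured from there, every later height
  on the cycle is nonnegative.\<close>

lemma dyck_rotate_exists:
  assumes "0 < a" "w \<in> compositions a b"
  shows "\<exists>m<a. rotate m w \<in> dyck a b"
proof -
  have len: "length w = a" and sum: "sum_list w = b"
    using assms(2) by (auto simp: compositions_def)
  define u where "u j = int j * int b - int a * int (sum_list (take j w))" for j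
  obtain m where m: "m < a" and min: "\<And>j. j < a \<Longrightarrow> u m \<le> u j"
    using ex_is_arg_min_if_finite[of "{..<a}" u] assms(1) by (auto simp: is_arg_min_linorder)
  have "u a = u 0" by (simp add: u_def len sum)
  then have min': "u m \<le> u j" if "j \<le> a" for j
    using min[of j] min[of 0] that assms(1) by (cases "j = a") auto
  have rot: "rotate m w = drop m w @ take m w"
    using m len by (simp add: rotate_drop_take)
  have "a * sum_list (take j (rotate m w)) \<le> j * b" if "j \<le> a" for j
  \<comment> \<open>A prefix of the rotation either stays inside \<open>drop m w\<close> or wraps
    around into \<open>take m w\<close>; in the latter case the total \<open>b\<close> gives the sum
    of the part already passed.\<close>
  proof (cases "j \<le> a - m")
    case True
    have "sum_list (take (m + j) w) = sum_list (take m w) + sum_list (take j (drop m w))"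
      by (simp add: take_add)
    moreover have "take j (rotate m w) = take j (drop m w)" using True len rot by simp
    ultimately have "int a * int (sum_list (take j (rotate m w))) \<le> int j * int b"
      using min'[of "m + j"] True m by (simp add: u_def algebra_simps)
    then show ?thesis by (simp flip: of_nat_mult)
  next
    case False
    define i where "i = j - (a - m)"
    have "i \<le> m" and j: "int j = int i + int a - int m"
      using False that m by (auto simp: i_def)
    have "take j (rotate m w) = drop m w @ take i w"
      using False len rot \<open>i \<le> m\<close> m by (simp add: i_def min_def)
    then have "int a * int (sum_list (take j (rotate m w)))
        = int a * (int b - int (sum_list (take m w)) + int (sum_list (take i w)))"
      using sum_list_take_drop[of m w] sum by simp
    then have "int a * int (sum_list (take j (rotate m w))) \<le> int j * int b"
      using min'[of i] \<open>i \<le> m\<close> m by (simp add: u_def j algebra_simps)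
    then show ?thesis by (simp flip: of_nat_mult)
  qed
  then show ?thesis
    using m rotate_in_compositions[OF assms(2)] by (auto simp: dyck_def)
qed

lemma bij_betw_rotate_dyck:
  assumes "coprime a b" "0 < a"
  shows "bij_betw (\<lambda>(z, k). rotate k z) (dyck a b \<times> {..<a}) (compositions a b)"
proof (intro bij_betw_imageI)
  have cancel: "rotate (a - k) (rotate k z) = z" if "z \<in> dyck a b" "k < a" for z k
    using that by (simp add: rotate_rotate rotate_id dyck_def compositions_def)
  show "inj_on (\<lambda>(z, k). rotate k z) (dyck a b \<times> {..<a})"
  proof -
    \<comment> \<open>For \<open>k \<le> k'\<close>, undoing \<open>k\<close> rotations exhibits
      \<open>z\<close> as a rotation of \<open>z'\<close> by \<open>k' - k < a\<close>, and two Dyck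
      compositions can only be related by the trivial one.\<close>
    have *: "z = z' \<and> k = k'"
      if z: "z \<in> dyck a b" and z': "z' \<in> dyck a b" and k: "k \<le> k'" "k' < a"
        and eq: "rotate k z = rotate k' z'" for z k z' k'
    proof -
      have "length z' = a" using z' by (simp add: dyck_def compositions_def)
      have "k < a" using k by linarith
      then have "z = rotate (a - k) (rotate k z)" using cancel[OF z] by metis
      also have "\<dots> = rotate (a - k) (rotate k' z')" by (simp only: eq)
      also have "\<dots> = rotate (a - k + k') z'" by (simp add: rotate_rotate)
      also have "a - k + k' = (k' - k) + a" using k by simp
      also have "rotate \<dots> z' = rotate (k' - k) z'"
        unfolding rotate_conv_mod[of "k' - k + a" z'] rotate_conv_mod[of "k' - k" z'] \<open>length z' = a\<close>
        by (simp only: mod_add_self2)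
      finally have eq': "z = rotate (k' - k) z'" .
      have "rotate (k' - k) z' \<in> dyck a b" using z by (subst eq'[symmetric])
      moreover have "k' - k < a" using k by linarith
      ultimately have "k' - k = 0" by (rule dyck_rotate_unique[OF assms(1) z'])
      then have "rotate (k' - k) z' = z'" "k = k'" using k by simp_all
      then show ?thesis using eq' by metis
    qed
    show ?thesis
    proof (intro inj_onI, clarify)
      fix z k z' k'
      assume "z \<in> dyck a b" "z' \<in> dyck a b" "k < a" "k' < a" "rotate k z = rotate k' z'"
      then show "z = z' \<and> k = k'"
        using *[of z z' k k'] *[of z' z k' k] by (cases "k \<le> k'") auto
    qed
  qed
  show "(\<lambda>(z, k). rotate k z) ` (dyck a b \<times> {..<a}) = compositions a b"
  proof (intro equalityI subsetI)
    fix w assume w: "w \<in> compositions a b"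
    then obtain m where m: "m < a" "rotate m w \<in> dyck a b"
      using dyck_rotate_exists assms(2) by blast
    have "length (rotate m w) = a" using w by (simp add: compositions_def)
    \<comment> \<open>The reduction modulo \<open>a\<close> matters for \<open>m = 0\<close>, where
      \<open>a - m\<close> would leave the range \<open>{..<a}\<close>.\<close>
    then have "rotate ((a - m) mod a) (rotate m w) = rotate (a - m) (rotate m w)"
      using rotate_conv_mod[of "a - m" "rotate m w"] by (simp only:)
    also have "\<dots> = w"
      using w m by (simp add: rotate_rotate rotate_id compositions_def)
    finally show "w \<in> (\<lambda>(z, k). rotate k z) ` (dyck a b \<times> {..<a})"
      using m assms(2) by (intro image_eqI[of _ _ "(rotate m w, (a - m) mod a)"]) auto
  qed (auto simp: dyck_def intro: rotate_in_compositions)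
qed

lemma sum_compositions_eq_dyck:
  fixes f :: "nat list \<Rightarrow> real"
  assumes "coprime a b" "0 < a" and f: "\<And>z k. f (rotate k z) = f z"
  shows "(\<Sum>z\<in>compositions a b. f z) = real a * (\<Sum>z\<in>dyck a b. f z)"
proof -
  have "(\<Sum>z\<in>compositions a b. f z) = (\<Sum>(z, k)\<in>dyck a b \<times> {..<a}. f z)"
    by (subst sum.reindex_bij_betw[OF bij_betw_rotate_dyck[OF assms(1,2)], symmetric])
      (simp add: f split_def)
  also have "\<dots> = real a * (\<Sum>z\<in>dyck a b. f z)"
    by (simp add: sum_distrib_left flip: sum.cartesian_product)
  finally show ?thesis .
qed

section \<open>Core sets and Dyck compositions\<close>

text \<open>For a Dyck composition, \<open>height b z j\<close> is the least element of the residue class of \<open>j * b\<close>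
  modulo \<open>length z\<close> outside the core set; the Dyck condition makes the subtraction exact.\<close>

definition height :: "nat \<Rightarrow> nat list \<Rightarrow> nat \<Rightarrow> nat" where
  "height b z j = j * b - length z * sum_list (take j z)"

definition core_set_of :: "nat \<Rightarrow> nat list \<Rightarrow> nat set" where
  "core_set_of b z = {x. \<exists>j<length z. x mod length z = (j * b) mod length z \<and> x < height b z j}"

definition level :: "nat \<Rightarrow> nat \<Rightarrow> nat set \<Rightarrow> nat \<Rightarrow> nat" where
  "level a b X j = (LEAST y. y \<notin> X \<and> y mod a = (j * b) mod a)"

text \<open>For a core set, adding \<open>b\<close> to the least gap in the class of
  \<open>j * b\<close> gives a gap in the next class; the part counts the steps of size
  \<open>a\<close> from there down to the least one.\<close>

definition dyck_of :: "nat \<Rightarrow> nat \<Rightarrow> nat set \<Rightarrow> nat list" where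
  "dyck_of a b X = map (\<lambda>j. (level a b X j + b - level a b X (Suc j)) div a) [0..<a]"

lemma dyck_height:
  assumes "z \<in> dyck a b" "j \<le> a"
  shows "height b z j + a * sum_list (take j z) = j * b"
  using assms by (simp add: height_def dyck_def compositions_def)

lemma mod_mult_eq_iff:
  fixes a b i j :: nat
  assumes "coprime a b" "i < a" "j < a"
  shows "(i * b) mod a = (j * b) mod a \<longleftrightarrow> i = j"
  using assms cong_mult_rcancel_nat[of b a i j]
  by (auto simp: cong_def coprime_commute)

lemma bij_betw_mult_mod:
  fixes a b :: nat
  assumes "coprime a b" "0 < a"
  shows "bij_betw (\<lambda>j. (j * b) mod a) {..<a} {..<a}"
  unfolding bij_betw_def
proof
  show inj: "inj_on (\<lambda>j. (j * b) mod a) {..<a}"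
    using mod_mult_eq_iff[OF assms(1)] by (auto intro: inj_onI)
  show "(\<lambda>j. (j * b) mod a) ` {..<a} = {..<a}"
    using inj assms(2) by (intro endo_inj_surj) auto
qed

context
  fixes a b :: nat
  assumes a_pos: "0 < a" and cop: "coprime a b"
begin

lemma ex_multiple_mod: "\<exists>j<a. x mod a = (j * b) mod a"
proof -
  have "x mod a \<in> (\<lambda>j. (j * b) mod a) ` {..<a}"
    using bij_betw_mult_mod[OF cop a_pos] a_pos by (simp add: bij_betw_def)
  then show ?thesis by auto
qed

section \<open>From Dyck compositions to core sets\<close>

lemma
  assumes "z \<in> dyck a b"
  shows height_0: "height b z 0 = 0"
    and height_last: "height b z a = 0"
    and height_Suc: "\<And>j. j < a \<Longrightarrow> height b z (Suc j) + a * (z ! j) = height b z j + b"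
    and height_mod: "\<And>j. j \<le> a \<Longrightarrow> height b z j mod a = (j * b) mod a"
proof -
  have len: "length z = a" and sum: "sum_list z = b"
    using assms by (auto simp: dyck_def compositions_def)
  show "height b z 0 = 0" "height b z a = 0"
    by (simp_all add: height_def len sum)
  show "height b z (Suc j) + a * (z ! j) = height b z j + b" if "j < a" for j
    using dyck_height[OF assms, of j] dyck_height[OF assms, of "Suc j"] that len
    by (simp add: take_Suc_conv_app_nth algebra_simps)
  show "height b z j mod a = (j * b) mod a" if "j \<le> a" for j
    using dyck_height[OF assms that] by (metis mod_mult_self2)
qed

text \<open>Subtracting \<open>a\<close> stays in the residue class, below the same height.
  Subtracting \<open>b\<close> moves to the preceding class, and from there the height rises by at
  most \<open>b\<close>, so the result is still below it.\<close>

lemma core_set_of_in_core_sets: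
  assumes z: "z \<in> dyck a b"
  shows "core_set_of b z \<in> core_sets a b"
proof -
  have len: "length z = a" using z by (auto simp: dyck_def compositions_def)
  have "core_set_of b z \<subseteq> {..<a * b}"
  proof
    fix x assume "x \<in> core_set_of b z"
    then obtain j where "j < a" "x < height b z j" by (auto simp: core_set_of_def len)
    moreover have "height b z j \<le> j * b" by (simp add: height_def)
    moreover have "j * b \<le> a * b" using \<open>j < a\<close> by simp
    ultimately show "x \<in> {..<a * b}" unfolding lessThan_iff by (meson less_le_trans)
  qed
  then have "finite (core_set_of b z)" using finite_subset by blast
  moreover have "0 \<notin> core_set_of b z"
    using mod_mult_eq_iff[OF cop, of 0] a_pos height_0[OF z]
    by (auto simp: core_set_of_def len) (metis gr0I less_irrefl)
  moreover have "x - a \<in> core_set_of b z" if "x \<in> core_set_of b z" "a \<le> x" for x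
    using that by (auto simp: core_set_of_def len le_mod_geq[symmetric])
  moreover have "x - b \<in> core_set_of b z" if x: "x \<in> core_set_of b z" "b \<le> x" for x
  proof -
    obtain j where j: "j < a" "x mod a = (j * b) mod a" "x < height b z j"
      using x(1) by (auto simp: core_set_of_def len)
    \<comment> \<open>The class of 0 has height 0 and contributes no elements, so \<open>j\<close>
      has a predecessor.\<close>
    then obtain i where i: "j = Suc i"
      using height_0[OF z] by (cases j) auto
    have "[x - b + b = i * b + b] (mod a)"
      using j i x by (simp add: cong_def add.commute)
    then have "(x - b) mod a = (i * b) mod a"
      by (simp only: cong_add_rcancel_nat) (simp add: cong_def)
    moreover have "x - b < height b z i"
      using height_Suc[OF z, of i] j i x by auto
    ultimately show ?thesis using j i by (auto simp: core_set_of_def len intro!: exI[of _ i])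
  qed
  ultimately show ?thesis by (auto simp: core_sets_def)
qed

lemma level_core_set_of:
  assumes z: "z \<in> dyck a b" and "j \<le> a"
  shows "level a b (core_set_of b z) j = height b z j"
proof -
  have len: "length z = a" using z by (auto simp: dyck_def compositions_def)
  have *: "level a b (core_set_of b z) j = height b z j" if "j < a" for j
    unfolding level_def
  proof (rule Least_equality)
    show "height b z j \<notin> core_set_of b z \<and> height b z j mod a = (j * b) mod a"
      using height_mod[OF z, of j] that by (auto simp: core_set_of_def len mod_mult_eq_iff[OF cop])
    show "height b z j \<le> y" if "y \<notin> core_set_of b z \<and> y mod a = (j * b) mod a" for y
      using that \<open>j < a\<close> by (auto simp: core_set_of_def len not_less)
  qed
  show ?thesis
  proof (cases "j = a")
    case True
    have "level a b (core_set_of b z) a = level a b (core_set_of b z) 0"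
      by (simp add: level_def)
    then show ?thesis using True *[of 0] a_pos height_0[OF z] height_last[OF z] by simp
  qed (use * assms(2) in auto)
qed

lemma dyck_of_core_set_of:
  assumes z: "z \<in> dyck a b"
  shows "dyck_of a b (core_set_of b z) = z"
proof (rule nth_equalityI)
  have len: "length z = a" using z by (auto simp: dyck_def compositions_def)
  then show "length (dyck_of a b (core_set_of b z)) = length z"
    by (simp add: dyck_of_def)
  fix j assume "j < length (dyck_of a b (core_set_of b z))"
  then have j: "j < a" by (simp add: dyck_of_def)
  have "height b z j + b - height b z (Suc j) = a * (z ! j)"
    using height_Suc[OF z j] by linarith
  then show "dyck_of a b (core_set_of b z) ! j = z ! j"
    using j a_pos by (simp add: dyck_of_def level_core_set_of[OF z])
qed

section \<open>From core sets back to Dyck compositions\<close>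

context
  fixes X assumes X: "X \<in> core_sets a b"
begin

lemma level_notin: "level a b X j \<notin> X" and level_mod: "level a b X j mod a = (j * b) mod a"
proof -
  have "finite X" using X by (simp add: core_sets_def)
  then obtain m where m: "\<forall>x\<in>X. x < m" using finite_nat_set_iff_bounded by blast
  \<comment> \<open>Since \<open>m\<close> bounds \<open>X\<close>, this number is a gap in the
    required class, so the least one exists.\<close>
  have "m \<le> j * b + m * a" using a_pos by (simp add: trans_le_add2)
  then have "j * b + m * a \<notin> X \<and> (j * b + m * a) mod a = (j * b) mod a"
    using m by auto
  then have "level a b X j \<notin> X \<and> level a b X j mod a = (j * b) mod a"
    unfolding level_def by (rule LeastI)
  then show "level a b X j \<notin> X" "level a b X j mod a = (j * b) mod a" by auto
qed

lemma level_le: "y \<notin> X \<Longrightarrow> y mod a = (j * b) mod a \<Longrightarrow> level a b X j \<le> y"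
  unfolding level_def by (rule Least_le) simp

text \<open>Closure under subtracting \<open>a\<close> makes the part of \<open>X\<close> in each
  residue class an initial segment of that class, so the levels determine \<open>X\<close>.\<close>

lemma mem_iff_less_level:
  assumes "x mod a = (j * b) mod a"
  shows "x \<in> X \<longleftrightarrow> x < level a b X j"
proof
  assume "x \<in> X"
  show "x < level a b X j"
  proof (rule ccontr)
    assume "\<not> x < level a b X j"
    then have le: "level a b X j \<le> x" by simp
    then have "a dvd x - level a b X j"
      using assms level_mod[of j] mod_eq_dvd_iff_nat[OF le, of a] by simp
    then obtain k where "x - level a b X j = k * a" by (auto simp: dvd_def mult.commute)
    then have k: "x = level a b X j + k * a" using le by linarith
    have "x - k * a \<in> X"
      using X \<open>x \<in> X\<close> k by (intro closed_under_multiples) (auto simp: core_sets_def)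
    then show False using level_notin k by simp
  qed
next
  assume "x < level a b X j"
  then show "x \<in> X" using level_le[of x j] assms by fastforce
qed

lemma level_0: "level a b X 0 = 0" and level_last: "level a b X a = 0"
proof -
  have "level a b X j = 0" if "(j * b) mod a = 0" for j
    using level_le[of 0 j] X that by (simp add: core_sets_def)
  then show "level a b X 0 = 0" "level a b X a = 0" by simp_all
qed

text \<open>By closure under subtracting \<open>b\<close>, a gap plus \<open>b\<close> is again a
  gap, so the next level is no larger. Both numbers are congruent modulo \<open>a\<close>, hence
  subtraction and division are exact.\<close>

lemma level_Suc: "level a b X (Suc j) + a * ((level a b X j + b - level a b X (Suc j)) div a) = level a b X j + b"
proof -
  have cong: "(level a b X j + b) mod a = (Suc j * b) mod a"
    using level_mod[of j] by (metis add.commute mod_add_left_eq mult_Suc)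
  have "level a b X j + b \<notin> X"
    using level_notin[of j] X by (force simp: core_sets_def)
  then have le: "level a b X (Suc j) \<le> level a b X j + b"
    using cong by (rule level_le)
  then have "a dvd level a b X j + b - level a b X (Suc j)"
    using cong level_mod[of "Suc j"] mod_eq_dvd_iff_nat[OF le, of a] by simp
  then show ?thesis using le by simp
qed

lemma level_telescope: "j \<le> a \<Longrightarrow> level a b X j + a * sum_list (take j (dyck_of a b X)) = j * b"
proof (induction j)
  case 0
  then show ?case by (simp add: level_0)
next
  case (Suc j)
  have "sum_list (take (Suc j) (dyck_of a b X))
      = sum_list (take j (dyck_of a b X)) + (level a b X j + b - level a b X (Suc j)) div a"
    using Suc.prems by (simp add: dyck_of_def take_Suc_conv_app_nth)
  then show ?case using Suc level_Suc[of j] by (simp add: algebra_simps)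
qed

lemma dyck_of_in_dyck: "dyck_of a b X \<in> dyck a b"
proof -
  have len: "length (dyck_of a b X) = a" by (simp add: dyck_of_def)
  moreover have "sum_list (dyck_of a b X) = b"
    using level_telescope[of a] a_pos len by (simp add: level_last)
  moreover have "a * sum_list (take j (dyck_of a b X)) \<le> j * b" if "j \<le> a" for j
    using level_telescope[OF that] by linarith
  ultimately show ?thesis by (simp add: dyck_def compositions_def)
qed

lemma core_set_of_dyck_of: "core_set_of b (dyck_of a b X) = X"
proof -
  have len: "length (dyck_of a b X) = a" by (simp add: dyck_of_def)
  have "height b (dyck_of a b X) j = level a b X j" if "j < a" for j
    using level_telescope[of j] that by (simp add: height_def len)
  then have "x \<in> core_set_of b (dyck_of a b X) \<longleftrightarrow> (\<exists>j<a. x mod a = (j * b) mod a \<and> x < level a b X j)" for x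
    by (auto simp: core_set_of_def len)
  then show ?thesis
    using ex_multiple_mod mem_iff_less_level by blast
qed

end

lemma bij_betw_core_set_of: "bij_betw (core_set_of b) (dyck a b) (core_sets a b)"
  by (rule bij_betw_byWitness[where f' = "dyck_of a b"])
    (auto simp: dyck_of_core_set_of core_set_of_dyck_of core_set_of_in_core_sets dyck_of_in_dyck)

section \<open>Sums over a core set, one residue class at a time\<close>

lemma sum_residue_class_below:
  fixes f :: "nat \<Rightarrow> real"
  assumes "r < a" "u mod a = r"
  shows "(\<Sum>x\<in>{x. x mod a = r \<and> x < u}. f x) = (\<Sum>k<u div a. f (r + k * a))"
proof (rule sum.reindex_bij_witness[of _ "\<lambda>k. r + k * a" "\<lambda>x. x div a"])
  fix x assume x: "x \<in> {x. x mod a = r \<and> x < u}"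
  then show "r + x div a * a = x" by (auto simp: mult.commute)
  \<comment> \<open>Both \<open>x\<close> and \<open>u\<close> have residue \<open>r\<close>, so
    comparing them amounts to comparing quotients.\<close>
  have "x div a * a + r < u div a * a + r"
    using x assms div_mult_mod_eq[of x a] div_mult_mod_eq[of u a] by simp
  then show "x div a \<in> {..<u div a}" using a_pos by simp
  show "f (r + x div a * a) = f x" using \<open>r + x div a * a = x\<close> by simp
next
  fix k assume k: "k \<in> {..<u div a}"
  show "(r + k * a) div a = k" using assms by simp
  have "k * a < u div a * a" using k a_pos by simp
  then have "r + k * a < u"
    using assms div_mult_mod_eq[of u a] by linarith
  then show "r + k * a \<in> {x. x mod a = r \<and> x < u}" using assms by auto
qed

lemma sum_core_set_of:
  fixes f :: "nat \<Rightarrow> real"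
  assumes z: "z \<in> dyck a b"
  shows "(\<Sum>x\<in>core_set_of b z. f x)
    = (\<Sum>j<a. \<Sum>k<height b z j div a. f ((j * b) mod a + k * a))"
proof -
  have len: "length z = a" using z by (auto simp: dyck_def compositions_def)
  let ?S = "\<lambda>j. {x. x mod a = (j * b) mod a \<and> x < height b z j}"
  have "core_set_of b z = (\<Union>j<a. ?S j)"
    by (auto simp: core_set_of_def len)
  also have "(\<Sum>x\<in>\<dots>. f x) = (\<Sum>j<a. \<Sum>x\<in>?S j. f x)"
    using mod_mult_eq_iff[OF cop] by (intro sum.UNION_disjoint) auto
  also have "\<dots> = (\<Sum>j<a. \<Sum>k<height b z j div a. f ((j * b) mod a + k * a))"
    using height_mod[OF z] a_pos by (intro sum.cong refl sum_residue_class_below) auto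
  finally show ?thesis .
qed

end

section \<open>The variance\<close>

text \<open>The left side is the size of the core. Summing each class as an arithmetic progression,
  the terms linear in the heights \<open>u\<close> cancel against those from the cardinality. What
  remains is \<open>a * (\<Sum>j<a. (u j)^2) - (\<Sum>j<a. u j)^2\<close> over
  \<open>2 * a^2\<close>, up to terms in the residues, which depend only on \<open>a\<close> and
  \<open>b\<close>.\<close>

lemma size_core_set_of:
  assumes "0 < a" "coprime a b"
  shows "\<exists>K. \<forall>z\<in>dyck a b. real (\<Sum>(core_set_of b z))
      - real (card (core_set_of b z)) * (real (card (core_set_of b z)) - 1) / 2 = K - quad z / 4"
proof -
  define r where "r j = (j * b) mod a" for j
  define R where "R = (\<Sum>j<a. (real (r j))\<^sup>2)"
  define V where "V = (real b)\<^sup>2 * (real a * (\<Sum>j<a. real j ^ 2) - (\<Sum>j<a. real j)\<^sup>2)"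
  have sum_r: "(\<Sum>j<a. real (r j)) = real a * (real a - 1) / 2"
    using sum.reindex_bij_betw[OF bij_betw_mult_mod[OF assms(2,1)], of real]
    by (simp add: r_def sum_real_lessThan)
  show ?thesis
  \<comment> \<open>The first two terms collect the residues, whose sum is
    \<open>a * (a - 1) / 2\<close>; the third is the part of \<open>variance_heights_eq_circ\<close>
    that is independent of \<open>z\<close>.\<close>
  proof (intro exI[of _ "(real a - 1)\<^sup>2 / 8 - R / (2 * real a) + V / (2 * (real a)\<^sup>2)"] ballI)
    fix z assume z: "z \<in> dyck a b"
    then have len: "length z = a" and sum: "sum_list z = b"
      by (auto simp: dyck_def compositions_def)
    define u where "u j = real (height b z j)" for j
    define X where "X = core_set_of b z"
    have decomp: "u j = real (height b z j div a) * real a + real (r j)" if "j < a" for j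
    proof -
      have "height b z j mod a = r j"
        using height_mod[OF assms z, of j] that by (simp add: r_def)
      then have "height b z j = height b z j div a * a + r j"
        by (metis div_mult_mod_eq)
      then show ?thesis
        unfolding u_def by (metis of_nat_add of_nat_mult)
    qed
    then have div: "real (height b z j div a) = (u j - real (r j)) / real a" if "j < a" for j
      using assms(1) that by (simp add: field_simps)
    have card: "real (card X) = ((\<Sum>j<a. u j) - real a * (real a - 1) / 2) / real a"
    proof -
      have "real (card X) = (\<Sum>j<a. (u j - real (r j)) / real a)"
        using sum_core_set_of[OF assms z, of "\<lambda>_. 1"] by (simp add: X_def div)
      then show ?thesis
        by (simp add: sum_subtractf sum_r flip: sum_divide_distrib)
    qed
    have inner: "(\<Sum>k<m. real (s + k * a)) = real m * real s + real a * (real m * (real m - 1) / 2)" for m s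
      by (simp add: sum.distrib flip: sum_real_lessThan sum_distrib_left sum_distrib_right)
    have "real (\<Sum>X) = (\<Sum>j<a. ((u j)\<^sup>2 - (real (r j))\<^sup>2) / (2 * real a) - (u j - real (r j)) / 2)"
    proof -
      have "real (\<Sum>X) = (\<Sum>j<a. \<Sum>k<height b z j div a. real (r j + k * a))"
        using sum_core_set_of[OF assms z, of real] by (simp add: X_def r_def)
      also have "\<dots> = (\<Sum>j<a. ((u j)\<^sup>2 - (real (r j))\<^sup>2) / (2 * real a) - (u j - real (r j)) / 2)"
      proof (intro sum.cong refl)
        fix j assume "j \<in> {..<a}"
        then show "(\<Sum>k<height b z j div a. real (r j + k * a))
            = ((u j)\<^sup>2 - (real (r j))\<^sup>2) / (2 * real a) - (u j - real (r j)) / 2"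
          unfolding inner using assms(1) by (simp add: decomp field_simps power2_eq_square)
      qed
      finally show ?thesis .
    qed
    then have sum_X: "real (\<Sum>X) = ((\<Sum>j<a. (u j)\<^sup>2) - R) / (2 * real a)
        - ((\<Sum>j<a. u j) - real a * (real a - 1) / 2) / 2"
      by (simp add: sum_subtractf sum_r R_def flip: sum_divide_distrib)
    have u: "u j = real j * (\<Sum>i<a. real (z ! i)) - real a * (\<Sum>i<j. real (z ! i))" if "j < a" for j
    proof -
      have prefix: "real (sum_list (take j z)) = (\<Sum>i<j. real (z ! i))" if "j \<le> a" for j
        using that len by (simp add: sum_list_sum_nth atLeast0LessThan)
      have "u j + real a * real (sum_list (take j z)) = real j * real b"
        using dyck_height[OF z, of j] that unfolding u_def by (metis less_imp_le of_nat_add of_nat_mult)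
      then show ?thesis
        using prefix[of j] prefix[of a] that sum len by simp
    qed
    have "(\<Sum>i<a. real (z ! i)) = real b"
      using sum len by (simp add: sum_list_sum_nth atLeast0LessThan flip: of_nat_sum)
    then have "real a * (\<Sum>j<a. (u j)\<^sup>2) - (\<Sum>j<a. u j)\<^sup>2 = V - (real a)\<^sup>2 / 2 * quad z"
      using variance_heights_eq_circ[of a "\<lambda>i. real (z ! i)"] by (simp add: u V_def quad_def len)
    then have quad: "(\<Sum>j<a. (u j)\<^sup>2) = (V - (real a)\<^sup>2 / 2 * quad z + (\<Sum>j<a. u j)\<^sup>2) / real a"
      using assms(1) by (simp add: field_simps)
    show "real (\<Sum>(core_set_of b z))
      - real (card (core_set_of b z)) * (real (card (core_set_of b z)) - 1) / 2
      = (real a - 1)\<^sup>2 / 8 - R / (2 * real a) + V / (2 * (real a)\<^sup>2) - quad z / 4"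
      using assms(1) unfolding X_def[symmetric] sum_X card quad
      by (simp add: field_simps power2_eq_square)
  qed
qed

text \<open>A single \<open>K\<close> serves every \<open>F\<close>, so the mean and the squared
  deviations are transferred with the same constant.\<close>

lemma sum_core_size:
  assumes "0 < a" "0 < b" "coprime a b"
  shows "\<exists>K. \<forall>F. (\<Sum>p\<in>core a b. F (real (partition_size p))) = (\<Sum>z\<in>dyck a b. F (K - quad z / 4) :: real)"
proof -
  obtain K where K: "\<And>z. z \<in> dyck a b \<Longrightarrow> real (\<Sum>(core_set_of b z))
      - real (card (core_set_of b z)) * (real (card (core_set_of b z)) - 1) / 2 = K - quad z / 4"
    using size_core_set_of[OF assms(1,3)] by blast
  let ?g = "\<lambda>X. real (\<Sum>X) - real (card X) * (real (card X) - 1) / 2"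
  have size: "real (partition_size p) = ?g (beta p)" if "p \<in> core a b" for p
  proof -
    have "is_partition p" using that by (simp add: core_def is_core_def)
    then show ?thesis
      by (simp add: card_beta sum_beta sum_real_lessThan)
  qed
  have "(\<Sum>p\<in>core a b. F (real (partition_size p))) = (\<Sum>z\<in>dyck a b. F (K - quad z / 4))" for F :: "real \<Rightarrow> real"
  proof -
    have "(\<Sum>p\<in>core a b. F (real (partition_size p))) = (\<Sum>p\<in>core a b. F (?g (beta p)))"
      using size by simp
    also have "\<dots> = (\<Sum>X\<in>core_sets a b. F (?g X))"
      by (rule sum.reindex_bij_betw[OF bij_betw_beta[OF assms(1,2)]])
    also have "\<dots> = (\<Sum>z\<in>dyck a b. F (?g (core_set_of b z)))"
      by (rule sum.reindex_bij_betw[OF bij_betw_core_set_of[OF assms(1,3)], symmetric])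
    also have "\<dots> = (\<Sum>z\<in>dyck a b. F (K - quad z / 4))"
      using K by simp
    finally show ?thesis .
  qed
  then show ?thesis by blast
qed

section \<open>Evaluation of the variance\<close>

lemma choose_Suc_ratio:
  "real ((n + b) choose (n + Suc k)) = real ((n + b) choose (n + k)) * (real b - real k) / (real n + real k + 1)"
proof -
  have "real (Suc (n + k) * ((n + b) choose Suc (n + k))) = real ((n + b) choose (n + k)) * (real b - real k)"
  proof (cases "k < b")
    case True
    then obtain d where b: "b = k + Suc d" using less_iff_Suc_add by auto
    show ?thesis
      using arg_cong[OF Suc_times_binomial_add[of "n + k" d], of real]
      by (simp add: b add.assoc algebra_simps)
  next
    case False
    \<comment> \<open>Both sides vanish: for \<open>k = b\<close> through the factor
      \<open>b - k\<close>, beyond that through the binomials.\<close>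
    then show ?thesis by (cases "k = b") (auto simp: binomial_eq_0)
  qed
  then show ?thesis by (simp add: field_simps)
qed

text \<open>Here \<open>p2\<close>, \<open>p3\<close>, \<open>p4\<close> stand for
  \<open>B K / B 0\<close>, while \<open>s\<close> and \<open>t\<close> are the row sums of
  \<open>circ\<close> and of its square. The divisor 16 comes from the factor \<open>1/4\<close> in
  front of \<open>quad\<close>.\<close>

lemma variance_identity:
  fixes a b :: real
  assumes "a > 0"
  defines "p2 \<equiv> b / a * (b - 1) / (a + 1)"
  defines "p3 \<equiv> p2 * (b - 2) / (a + 2)"
  defines "p4 \<equiv> p3 * (b - 3) / (a + 3)"
  defines "s \<equiv> a * (a\<^sup>2 - 1) / 6" and "t \<equiv> a * (a ^ 4 - 1) / 30"
  shows "(p4 * (a * s)\<^sup>2 + 4 * (p4 + p3) * (a * s\<^sup>2) + 2 * (p4 + 2 * p3 + p2) * (a * t) - (p2 * (a * s))\<^sup>2) / 16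
    = a * b * (a - 1) * (b - 1) * (a + b) * (a + b + 1) / 1440"
proof -
  have "a \<noteq> 0" "a + 1 \<noteq> 0" "a + 2 \<noteq> 0" "a + 3 \<noteq> 0" using assms(1) by auto
  then show ?thesis
    unfolding p4_def p3_def p2_def s_def t_def
    by (simp add: divide_simps) algebra
qed

lemma variance_over_eq:
  assumes "finite S" "S \<noteq> {}"
  shows "variance_over S X = (\<Sum>x\<in>S. (X x)\<^sup>2) / real (card S) - ((\<Sum>x\<in>S. X x) / real (card S))\<^sup>2"
proof -
  define N where "N = real (card S)"
  have "N > 0" using assms by (simp add: N_def card_gt_0_iff)
  have expand: "(\<Sum>x\<in>S. (X x - \<mu>)\<^sup>2) = (\<Sum>x\<in>S. (X x)\<^sup>2) - 2 * \<mu> * (\<Sum>x\<in>S. X x) + N * \<mu>\<^sup>2" for \<mu>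
    by (simp add: power2_diff sum.distrib sum_subtractf N_def mult_ac
        flip: sum_distrib_left sum_distrib_right)
  show ?thesis
    unfolding variance_over_def mean_over_def N_def[symmetric] expand
    using \<open>N > 0\<close> by (simp add: field_simps power2_eq_square)
qed

lemma variance_over_affine:
  assumes "finite S" "S \<noteq> {}"
  shows "variance_over S (\<lambda>x. K - X x / c) = variance_over S X / c\<^sup>2"
proof -
  have "mean_over S (\<lambda>x. K - X x / c) = K - mean_over S X / c"
    using assms by (simp add: mean_over_def sum_subtractf diff_divide_distrib flip: sum_divide_distrib)
  then have "(K - X x / c - mean_over S (\<lambda>x. K - X x / c))\<^sup>2 = (X x - mean_over S X)\<^sup>2 / c\<^sup>2" for x
    by (simp add: power_divide power2_commute flip: diff_divide_distrib)
  then show ?thesis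
    by (simp add: variance_over_def flip: sum_divide_distrib)
qed

text \<open>Since \<open>quad\<close> is invariant under rotation, sums over all compositions are
  \<open>a\<close> times sums over Dyck ones, so the averages agree and the moment formulas
  apply.\<close>

lemma variance_over_dyck_quad:
  assumes "0 < a" "coprime a b"
  shows "variance_over (dyck a b) quad / 16
    = real a * real b * (real a - 1) * (real b - 1) * (real a + real b) * (real a + real b + 1) / 1440"
    and "dyck a b \<noteq> {}" and "finite (dyck a b)"
proof -
  obtain n where n: "a = Suc n" using assms(1) gr0_implies_Suc by blast
  let ?C = "compositions a b"
  define B where "B K = real ((n + b) choose (n + K))" for K
  define s where "s = real a * ((real a)\<^sup>2 - 1) / 6"
  define t where "t = real a * (real a ^ 4 - 1) / 30"
  have dyck: "(\<Sum>z\<in>?C. f (quad z)) = real a * (\<Sum>z\<in>dyck a b. f (quad z))" for f :: "real \<Rightarrow> real"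
    using assms by (intro sum_compositions_eq_dyck) (auto simp: quad_rotate)
  have C0: "real (card ?C) = B 0"
    using sum_prod_choose_compositions[of "\<lambda>_. 0" n b] by (simp add: n B_def)
  have B0: "B 0 > 0" by (simp add: B_def)
  have quad: "quad z = (\<Sum>i\<le>n. \<Sum>j\<le>n. circ a i j * (real (z ! i) * real (z ! j)))" if "z \<in> ?C" for z
    using that by (simp add: quad_def compositions_def n lessThan_Suc_atMost)
  have rows: "(\<Sum>j\<le>n. circ a i j) = s" "(\<Sum>j\<le>n. (circ a i j)\<^sup>2) = t" if "i \<le> n" for i
    using sum_circ[of i a] sum_circ_squared[of i a] that
    by (simp_all add: n s_def t_def lessThan_Suc_atMost)
  have C1: "(\<Sum>z\<in>?C. quad z) = B 2 * (real a * s)"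
    using sum_quadratic_form_compositions[of "circ a" n b]
    by (simp add: quad circ_diag rows n[symmetric] B_def)
  have C2: "(\<Sum>z\<in>?C. (quad z)\<^sup>2) = B 4 * (real a * s)\<^sup>2 + 4 * (B 4 + B 3) * (real a * s\<^sup>2)
      + 2 * (B 4 + 2 * B 3 + B 2) * (real a * t)"
    using sum_quadratic_form_squared_compositions[of "circ a" n b, OF circ_diag circ_sym]
    by (simp add: quad rows n[symmetric] B_def)
  define N where "N = real (card (dyck a b))"
  \<comment> \<open>This makes \<open>N\<close> the rational Catalan number
    \<open>((a + b) choose a) / (a + b)\<close>.\<close>
  have N: "B 0 = real a * N"
    using dyck[of "\<lambda>_. 1"] by (simp add: C0 N_def)
  show "finite (dyck a b)"
    by (rule finite_subset[of _ ?C]) (auto simp: dyck_def)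
  moreover show "dyck a b \<noteq> {}"
    using N B0 by (auto simp: N_def)
  ultimately have var: "variance_over (dyck a b) quad = (\<Sum>z\<in>?C. (quad z)\<^sup>2) / B 0 - ((\<Sum>z\<in>?C. quad z) / B 0)\<^sup>2"
    using assms(1) dyck[of "\<lambda>x. x"] dyck[of "\<lambda>x. x\<^sup>2"]
    by (simp add: variance_over_eq N N_def[symmetric])
  define p where "p K = B K / B 0" for K
  have ratio: "B (Suc k) = B k * (real b - real k) / (real a + real k)" for k
    using choose_Suc_ratio[of n b k] by (simp add: B_def n add_ac)
  have p2: "p 2 = real b / real a * (real b - 1) / (real a + 1)"
    using B0 ratio[of 0] ratio[of 1] by (simp add: p_def numeral_2_eq_2)
  have p3: "p 3 = p 2 * (real b - 2) / (real a + 2)"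
    using ratio[of 2] by (simp add: p_def)
  have p4: "p 4 = p 3 * (real b - 3) / (real a + 3)"
    using ratio[of 3] by (simp add: p_def)
  have "variance_over (dyck a b) quad = p 4 * (real a * s)\<^sup>2 + 4 * (p 4 + p 3) * (real a * s\<^sup>2)
      + 2 * (p 4 + 2 * p 3 + p 2) * (real a * t) - (p 2 * (real a * s))\<^sup>2"
    unfolding var C1 C2 p_def using B0 by (simp add: field_simps power2_eq_square)
  then show "variance_over (dyck a b) quad / 16
    = real a * real b * (real a - 1) * (real b - 1) * (real a + real b) * (real a + real b + 1) / 1440"
    using variance_identity[of "real a" "real b"] assms(1)
    unfolding p4 p3 p2 s_def t_def by simp
qed

theorem theorem1p5:
  fixes a b :: nat
  assumes "a > 0" and "b > 0" and "gcd a b = 1"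
  shows "finite (core a b) \<and>
    variance_over (core a b) (\<lambda>l. real (partition_size l)) =
      real a * real b * (real a - 1) * (real b - 1) * (real a + real b) * (real a + real b + 1) / 1440"
proof -
  have cop: "coprime a b" using assms(3) by (simp add: coprime_iff_gcd_eq_1)
  note dyck = variance_over_dyck_quad[OF assms(1) cop]
  have bij: "bij_betw (core_set_of b) (dyck a b) (core_sets a b)"
    by (rule bij_betw_core_set_of[OF assms(1) cop])
  have fin: "finite (core a b)"
    using bij_betw_finite[OF bij] bij_betw_finite[OF bij_betw_beta[OF assms(1,2)]] dyck(3) by simp
  have card: "card (core a b) = card (dyck a b)"
    using bij_betw_same_card[OF bij] bij_betw_same_card[OF bij_betw_beta[OF assms(1,2)]] by simp
  obtain K where K: "\<And>F :: real \<Rightarrow> real. (\<Sum>p\<in>core a b. F (real (partition_size p))) = (\<Sum>z\<in>dyck a b. F (K - quad z / 4))"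
    using sum_core_size[OF assms(1,2) cop] by blast
  have "mean_over (core a b) (\<lambda>l. real (partition_size l)) = mean_over (dyck a b) (\<lambda>z. K - quad z / 4)"
    using K[of "\<lambda>x. x"] by (simp add: mean_over_def card)
  \<comment> \<open>As the means agree, \<open>F\<close> can be taken as the squared deviation from
    the common mean.\<close>
  then have "variance_over (core a b) (\<lambda>l. real (partition_size l)) = variance_over (dyck a b) (\<lambda>z. K - quad z / 4)"
    using K[of "\<lambda>x. (x - mean_over (dyck a b) (\<lambda>z. K - quad z / 4))\<^sup>2"] by (simp add: variance_over_def card)
  also have "\<dots> = variance_over (dyck a b) quad / 16"
    using variance_over_affine[OF dyck(3,2), of K quad 4] by simp
  finally show ?thesis using fin dyck(1) by simp
qed

end
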